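(* Let $F$ be a CDF on $\mathbb R$ with $\int|w|\,\mathrm dF(w)<\infty$ and with density $f:\mathbb R\to\mathbb R_+$. Suppose that $f$ has a super-exponential left tail, i.e. for some $\omega\in\mathbb R$, $f$ is continuously differentiable and strictly positive on $(-\infty,\omega)$ and $\lim_{w\to-\infty}(\log f)'(w)=+\infty$. Then there exist an insurance menu $B=\{\mathbf 0,b\}$, a binary (i.e. $|X|=2$) MLR-ordered experiment $\alpha$, and increasing, Lipschitz continuous, concave utility functions $u,v$ satisfying (ZAZI) such that $u$ is more risk averse than $v$ and $$M(u)<M(v),$$ where $M$ is willingness to pay for information in the environment $(F,B,\alpha)$.
   Context: $F$-integrable means measurable with $\int|\cdot|\,\mathrm dF<\infty$. $U$ is the set of strictly increasing functions $u:\mathbb R\to\mathbb R$ that are $F$-integrable, absolutely continuous on every bounded interval, and satisfy $\limsup_{m\to\infty}u(m)/m<\infty$; utility functions are elements of $U$. For $u,v\in U$, $v$ is more risk averse than $u$ if $v=\phi\circ u$ for some increasing and (weakly) concave $\phi:\mathbb R\to\mathbb R$ ("increasing" is in the strict sense). An asset is an $F$-integrable map $b:\mathbb R\to\mathbb R$; $\mathbf 0$ is the zero asset (status quo). A menu $B$ is a set of assets containing $\mathbf 0$ and compact in the $L^1(F)$ metric. An insurance is an asset $b$ that is nonincreasing and such that $w\mapsto w+b(w)$ is nondecreasing. $B$ is an insurance menu if each $b\in B$ is an insurance and there exist $w^*\in\mathbb R\cup\{\pm\infty\}$ and a complete ordering $\succeq$ of $B$ such that, for all $b,b'\in B$ with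 $b'\succeq b$: $b'(w)\ge b(w)$ for all real $w\le w^*$ and $b'(w)\le b(w)$ for all real $w\ge w^*$. An experiment is $\alpha=(X,(h_w)_{w\in\mathbb R})$ with $X\subset\mathbb R$ finite, each $h_w$ a probability mass function on $X$, $w\mapsto h_w(x)$ measurable for each $x$, and $h(x)=\int h_w(x)\,\mathrm dF(w)>0$ for every $x\in X$. It is MLR-ordered if $h_w(x)h_{w'}(x')\ge h_w(x')h_{w'}(x)$ whenever $w\le w'$ and $x\le x'$. The posterior after $x$ has density $f_x(w)=h_w(x)f(w)/h(x)$ and CDF $F_x$. A strategy is $\beta=(\beta_x)_{x\in X}\in B^X$. For $\mu\ge0$, $G^\mu_\beta(m)=\sum_{x\in X}h(x)\int\mathbf 1_{\{w+\beta_x(w)-\mu\le m\}}\,\mathrm dF_x(w)$. For each $u\in U$, the integrals $\int u\,\mathrm dG^\mu_\beta$ exist in $\mathbb R\cup\{-\infty\}$ and the maximum over $\beta\in B^X$ is attained; $M(u)\in\mathbb R_+$ is the unique number such that $\max_{\beta}\int u\,\mathrm dG^\mu_\beta<\int u\,\mathrm dF$ for all $\mu>M(u)$ and $\max_{\beta}\int u\,\mathrm dG^\mu_\beta>\int u\,\mathrm dF$ for all $0\le\mu<M(u)$. (ZAZI) for $u$: $\mathbf 0\in\arg\max_{b\in B}\int u(w+b(w))\,\mathrm dF(w)$. *)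

theory Defs
  imports "HOL-Probability.Probability"
begin

section \<open>Distributions\<close>

text \<open>Distributions are given by their CDFs; the integral with respect to \<open>dF\<close> is the integral
  over \<^term>\<open>interval_measure F\<close>, the Lebesgue--Stieltjes measure of \<open>F\<close>.\<close>

definition is_CDF :: "(real \<Rightarrow> real) \<Rightarrow> bool" where
  "is_CDF F \<longleftrightarrow> (\<exists>D. real_distribution D \<and> F = cdf D)"

definition has_density :: "(real \<Rightarrow> real) \<Rightarrow> (real \<Rightarrow> real) \<Rightarrow> bool" where
  "has_density F f \<longleftrightarrow> f \<in> borel_measurable borel \<and> (\<forall>w. 0 \<le> f w) \<and>
     (\<forall>m. set_integrable lborel {..m} f \<and> F m = (LINT w:{..m}|lborel. f w))"

definition super_exponential_left_tail :: "(real \<Rightarrow> real) \<Rightarrow> bool" where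
  "super_exponential_left_tail f \<longleftrightarrow>
     (\<exists>\<omega>. f C1_differentiable_on {..<\<omega>} \<and> (\<forall>w<\<omega>. 0 < f w) \<and>
          filterlim (deriv (\<lambda>w. ln (f w))) at_top at_bot)"

abbreviation F_integrable :: "(real \<Rightarrow> real) \<Rightarrow> (real \<Rightarrow> real) \<Rightarrow> bool" where
  "F_integrable F g \<equiv> integrable (interval_measure F) g"

text \<open>Integral with values in the extended reals, meaningful whenever the positive part of the
  integrand has finite integral.\<close>

definition ext_integral :: "'a measure \<Rightarrow> ('a \<Rightarrow> real) \<Rightarrow> ereal" where
  "ext_integral D g =
     enn2ereal (\<integral>\<^sup>+ w. ennreal (g w) \<partial>D) - enn2ereal (\<integral>\<^sup>+ w. ennreal (- g w) \<partial>D)"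


section \<open>Utility functions\<close>

definition abs_continuous_between :: "(real \<Rightarrow> real) \<Rightarrow> real \<Rightarrow> real \<Rightarrow> bool" where
  "abs_continuous_between u a b \<longleftrightarrow>
     (\<forall>\<epsilon>>0. \<exists>\<delta>>0. \<forall>(n::nat) c d.
        (\<forall>i<n. a \<le> c i \<and> c i \<le> d i \<and> d i \<le> b) \<and>
        disjoint_family_on (\<lambda>i. {c i<..<d i}) {..<n} \<and>
        (\<Sum>i<n. d i - c i) < \<delta>
        \<longrightarrow> (\<Sum>i<n. \<bar>u (d i) - u (c i)\<bar>) < \<epsilon>)"

definition utilities :: "(real \<Rightarrow> real) \<Rightarrow> (real \<Rightarrow> real) set" where
  "utilities F = {u. strict_mono u \<and> F_integrable F u \<and>
     (\<forall>a b. abs_continuous_between u a b) \<and>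
     Limsup at_top (\<lambda>m. ereal (u m / m)) < \<infinity>}"

definition more_risk_averse :: "(real \<Rightarrow> real) \<Rightarrow> (real \<Rightarrow> real) \<Rightarrow> bool" where
  "more_risk_averse v u \<longleftrightarrow> (\<exists>\<phi>. strict_mono \<phi> \<and> concave_on UNIV \<phi> \<and> v = \<phi> \<circ> u)"


section \<open>Assets and menus\<close>

definition zero_asset :: "real \<Rightarrow> real" where
  "zero_asset = (\<lambda>_. 0)"

text \<open>The topology of the \<open>L\<^sup>1(F)\<close> metric, on integrable functions rather than on almost-everywhere
  equivalence classes. Passing to the classes does not change which sets are compact.\<close>

definition L1_ball :: "(real \<Rightarrow> real) \<Rightarrow> (real \<Rightarrow> real) \<Rightarrow> real \<Rightarrow> (real \<Rightarrow> real) set" where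
  "L1_ball F b r = {b'. F_integrable F b' \<and> (LINT w|interval_measure F. \<bar>b' w - b w\<bar>) < r}"

definition L1_topology :: "(real \<Rightarrow> real) \<Rightarrow> (real \<Rightarrow> real) topology" where
  "L1_topology F = topology_generated_by {L1_ball F b r | b r. F_integrable F b}"

definition menu :: "(real \<Rightarrow> real) \<Rightarrow> (real \<Rightarrow> real) set \<Rightarrow> bool" where
  "menu F B \<longleftrightarrow> (\<forall>b\<in>B. F_integrable F b) \<and> zero_asset \<in> B \<and> compactin (L1_topology F) B"

definition insurance :: "(real \<Rightarrow> real) \<Rightarrow> (real \<Rightarrow> real) \<Rightarrow> bool" where
  "insurance F b \<longleftrightarrow> F_integrable F b \<and> antimono b \<and> mono (\<lambda>w. w + b w)"

text \<open>Below, \<open>(b, b') \<in> R\<close> stands for \<open>b' \<succeq> b\<close>.\<close>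

definition insurance_menu :: "(real \<Rightarrow> real) \<Rightarrow> (real \<Rightarrow> real) set \<Rightarrow> bool" where
  "insurance_menu F B \<longleftrightarrow> menu F B \<and> (\<forall>b\<in>B. insurance F b) \<and>
     (\<exists>(wstar::ereal) R. linear_order_on B R \<and>
        (\<forall>b b'. (b, b') \<in> R \<longrightarrow>
           (\<forall>w. ereal w \<le> wstar \<longrightarrow> b w \<le> b' w) \<and>
           (\<forall>w. wstar \<le> ereal w \<longrightarrow> b' w \<le> b w)))"

definition ZAZI :: "(real \<Rightarrow> real) \<Rightarrow> (real \<Rightarrow> real) set \<Rightarrow> (real \<Rightarrow> real) \<Rightarrow> bool" where
  "ZAZI F B u \<longleftrightarrow>
     is_arg_max (\<lambda>b. ext_integral (interval_measure F) (\<lambda>w. u (w + b w))) (\<lambda>b. b \<in> B) zero_asset"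


section \<open>Experiments\<close>

definition marginal :: "(real \<Rightarrow> real) \<Rightarrow> (real \<Rightarrow> real pmf) \<Rightarrow> real \<Rightarrow> real" where
  "marginal F h x = (LINT w|interval_measure F. pmf (h w) x)"

definition is_experiment :: "(real \<Rightarrow> real) \<Rightarrow> real set \<Rightarrow> (real \<Rightarrow> real pmf) \<Rightarrow> bool" where
  "is_experiment F X h \<longleftrightarrow> finite X \<and> (\<forall>w. set_pmf (h w) \<subseteq> X) \<and>
     (\<forall>x\<in>X. (\<lambda>w. pmf (h w) x) \<in> borel_measurable borel \<and> 0 < marginal F h x)"

definition MLR_ordered :: "real set \<Rightarrow> (real \<Rightarrow> real pmf) \<Rightarrow> bool" where
  "MLR_ordered X h \<longleftrightarrow>
     (\<forall>w w'. \<forall>x\<in>X. \<forall>x'\<in>X. w \<le> w' \<and> x \<le> x' \<longrightarrow>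
        pmf (h w') x * pmf (h w) x' \<le> pmf (h w) x * pmf (h w') x')"

definition posterior_density ::
    "(real \<Rightarrow> real) \<Rightarrow> (real \<Rightarrow> real) \<Rightarrow> (real \<Rightarrow> real pmf) \<Rightarrow> real \<Rightarrow> real \<Rightarrow> real" where
  "posterior_density F f h x w = pmf (h w) x * f w / marginal F h x"

definition posterior_CDF ::
    "(real \<Rightarrow> real) \<Rightarrow> (real \<Rightarrow> real) \<Rightarrow> (real \<Rightarrow> real pmf) \<Rightarrow> real \<Rightarrow> real \<Rightarrow> real" where
  "posterior_CDF F f h x m = (LINT w:{..m}|lborel. posterior_density F f h x w)"


section \<open>Willingness to pay for information\<close>

definition wealth_CDF ::
    "(real \<Rightarrow> real) \<Rightarrow> (real \<Rightarrow> real) \<Rightarrow> real set \<Rightarrow> (real \<Rightarrow> real pmf) \<Rightarrow>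
     real \<Rightarrow> (real \<Rightarrow> real \<Rightarrow> real) \<Rightarrow> real \<Rightarrow> real" where
  "wealth_CDF F f X h \<mu> \<beta> m =
     (\<Sum>x\<in>X. marginal F h x *
        (LINT w|interval_measure (posterior_CDF F f h x). indicator {w. w + \<beta> x w - \<mu> \<le> m} w))"

definition max_expected_utility ::
    "(real \<Rightarrow> real) \<Rightarrow> (real \<Rightarrow> real) \<Rightarrow> (real \<Rightarrow> real) set \<Rightarrow> real set \<Rightarrow> (real \<Rightarrow> real pmf) \<Rightarrow>
     (real \<Rightarrow> real) \<Rightarrow> real \<Rightarrow> ereal" where
  "max_expected_utility F f B X h u \<mu> =
     (GREATEST e. \<exists>\<beta> \<in> X \<rightarrow>\<^sub>E B. e = ext_integral (interval_measure (wealth_CDF F f X h \<mu> \<beta>)) u)"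

definition is_willingness_to_pay ::
    "(real \<Rightarrow> real) \<Rightarrow> (real \<Rightarrow> real) \<Rightarrow> (real \<Rightarrow> real) set \<Rightarrow> real set \<Rightarrow> (real \<Rightarrow> real pmf) \<Rightarrow>
     (real \<Rightarrow> real) \<Rightarrow> real \<Rightarrow> bool" where
  "is_willingness_to_pay F f B X h u M \<longleftrightarrow> 0 \<le> M \<and>
     (\<forall>\<mu>>M. max_expected_utility F f B X h u \<mu> < ereal (LINT w|interval_measure F. u w)) \<and>
     (\<forall>\<mu>. 0 \<le> \<mu> \<and> \<mu> < M \<longrightarrow>
        ereal (LINT w|interval_measure F. u w) < max_expected_utility F f B X h u \<mu>)"

lemma is_willingness_to_pay_unique:
  assumes "is_willingness_to_pay F f B X h u M" "is_willingness_to_pay F f B X h u M'"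
  shows "M = M'"
proof -
  have "\<not> m < m'"
    if "is_willingness_to_pay F f B X h u m" "is_willingness_to_pay F f B X h u m'" for m m'
  proof
    assume "m < m'"
    then obtain \<mu> where "m < \<mu>" "\<mu> < m'" using dense by blast
    moreover have "0 \<le> \<mu>"
      using that(1) \<open>m < \<mu>\<close> unfolding is_willingness_to_pay_def by linarith
    ultimately show False
      using that unfolding is_willingness_to_pay_def by (meson less_asym)
  qed
  with assms show ?thesis by (meson linorder_neqE)
qed

definition willingness_to_pay ::
    "(real \<Rightarrow> real) \<Rightarrow> (real \<Rightarrow> real) \<Rightarrow> (real \<Rightarrow> real) set \<Rightarrow> real set \<Rightarrow> (real \<Rightarrow> real pmf) \<Rightarrow>
     (real \<Rightarrow> real) \<Rightarrow> real" where
  "willingness_to_pay F f B X h u = (THE M. is_willingness_to_pay F f B X h u M)"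

end

theory Submission
  imports Defs
begin

text \<open>
  Let \<open>v\<close> be risk neutral and let \<open>u(w) = w - t (k - w)\<^sup>+\<close> add a small kink at a low wealth level \<open>k\<close>.
  The asset is full insurance \<open>b(w) = c - w\<close> with \<open>c = E w - 1\<close>, so that the premium is unfair and
  (ZAZI) holds. The low signal has probability \<open>1/2\<close> in states \<open>w \<le> c\<close> and probability \<open>0\<close> otherwise;
  buying insurance after it is worth \<open>\<mu> = E (c - w)\<^sup>+ / 2\<close> to \<open>v\<close>. At the fee \<open>\<mu>\<close>, an agent with utility
  \<open>u\<close> still loses \<open>\<mu>\<close> with probability at least \<open>1/2\<close> in every state, so that the expected shortfall
  below \<open>k\<close> is at least \<open>\<Phi>(k + \<mu>) / 2\<close> for \<open>\<Phi>(k) = E (k - w)\<^sup>+\<close>, against \<open>\<Phi>(k)\<close> without information.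
  The super-exponential tail makes \<open>\<Phi>(k + \<mu>) / \<Phi>(k)\<close> exceed \<open>2\<close> for low \<open>k\<close>, hence \<open>M(u) < \<mu> = M(v)\<close>.
\<close>

section \<open>Laws of wealth\<close>

text \<open>A probability law is determined by its CDF. Applied to \<open>F\<close>, to the
  posteriors and to final wealth, this replaces Lebesgue-Stieltjes measures by explicitly
  constructed laws.\<close>

lemma interval_measure_eqI:
  assumes "real_distribution D" and "\<And>m. G m = cdf D m"
  shows "interval_measure G = D"
proof -
  interpret real_distribution D by fact
  have G: "G = cdf D"
    using assms(2) by auto
  show ?thesis
    unfolding G
    by (intro cdf_unique real_distribution_interval_measure assms(1) cdf_interval_measure)
      (auto intro: cdf_nondecreasing cdf_is_right_cont cdf_lim_at_bot cdf_lim_at_top_prob)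
qed

text \<open>Integrability makes both parts finite, so the difference of extended reals is an
  ordinary one.\<close>

lemma ext_integral_eq_integral:
  assumes "integrable D g"
  shows "ext_integral D g = ereal (LINT w|D. g w)"
proof -
  have "(\<integral>\<^sup>+ w. ennreal (g w) \<partial>D) \<noteq> \<infinity>" "(\<integral>\<^sup>+ w. ennreal (- g w) \<partial>D) \<noteq> \<infinity>"
    using assms unfolding real_integrable_def by auto
  then obtain p n where "p \<ge> 0" "(\<integral>\<^sup>+ w. ennreal (g w) \<partial>D) = ennreal p"
      "n \<ge> 0" "(\<integral>\<^sup>+ w. ennreal (- g w) \<partial>D) = ennreal n"
    by (metis ennreal_cases infinity_ennreal_def)
  then show ?thesis
    using real_lebesgue_integral_def[OF assms] by (simp add: ext_integral_def)
qed

section \<open>The prior and its density\<close>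

locale density_environment =
  fixes F f :: "real \<Rightarrow> real"
  assumes is_CDF: "is_CDF F" and has_density: "has_density F f"
begin

lemma f_measurable [measurable]: "f \<in> borel_measurable borel"
  and f_nonneg: "0 \<le> f w"
  using has_density unfolding has_density_def by auto

lemma real_distribution_F: "real_distribution (interval_measure F)"
  using is_CDF interval_measure_eqI unfolding is_CDF_def by metis

sublocale F: real_distribution "interval_measure F"
  by (rule real_distribution_F)

lemma prob_F_UNIV: "F.prob UNIV = 1"
  using F.prob_space by simp

lemma cdf_F: "cdf (interval_measure F) = F"
  using is_CDF interval_measure_eqI unfolding is_CDF_def by metis

text \<open>The density is given only through integrals over half-lines; these already say that the
  two measures have the same CDF, which suffices once both are known to be finite.\<close>

lemma interval_measure_eq_density: "interval_measure F = density lborel (\<lambda>w. ennreal (f w))"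
  (is "_ = ?D")
proof (rule cdf_unique')
  have Iic: "emeasure ?D {..m} = ennreal (F m)" for m
  proof -
    have "emeasure ?D {..m} = (\<integral>\<^sup>+ w. ennreal (indicator {..m} w * f w) \<partial>lborel)"
      by (subst emeasure_density) (auto intro!: nn_integral_cong split: split_indicator)
    also have "\<dots> = ennreal (LINT w|lborel. indicator {..m} w * f w)"
      using has_density f_nonneg
      by (intro nn_integral_eq_integral) (auto simp: has_density_def set_integrable_def)
    also have "\<dots> = ennreal (F m)"
      using has_density by (simp add: has_density_def set_lebesgue_integral_def)
    finally show ?thesis .
  qed
  have F01: "0 \<le> F m \<and> F m \<le> 1" for m
    using F.cdf_nonneg[of m] F.cdf_bounded_prob[of m] by (simp add: cdf_F)
  have UN: "(\<Union>n::nat. {..real n}) = UNIV"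
    by (auto intro: real_arch_simple)
  \<comment> \<open>Finiteness of the density measure: its total mass is the supremum of the values
    \<open>F n\<close>, all at most 1.\<close>
  have "emeasure ?D UNIV = (SUP n. emeasure ?D {..real n})"
    unfolding UN[symmetric] by (intro SUP_emeasure_incseq[symmetric]) (auto simp: incseq_def)
  also have "\<dots> \<le> 1"
    using F01 by (auto intro!: SUP_least simp: Iic)
  finally have "emeasure ?D UNIV \<noteq> \<infinity>"
    by (auto simp: top_unique)
  then show "finite_borel_measure ?D"
    by (auto intro!: finite_borel_measure.intro finite_measureI finite_borel_measure_axioms.intro)
  show "finite_borel_measure (interval_measure F)"
    by (rule F.finite_borel_measure_M)
  show "cdf (interval_measure F) = cdf ?D"
    using F01 by (auto simp: cdf_F cdf_def2[of ?D] measure_def Iic)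
qed

lemma integrable_pmf_F:
  assumes "(\<lambda>w. pmf (h w) x) \<in> borel_measurable borel"
  shows "integrable (interval_measure F) (\<lambda>w. pmf (h w) x)"
  using assms by (intro F.integrable_const_bound[of _ 1]) (auto simp: pmf_le_1)

text \<open>Bayes' rule relative to the prior: the factor \<open>f\<close> of the posterior density
  is absorbed into \<open>interval_measure F\<close>, leaving the likelihood divided by its
  mean.\<close>

lemma interval_measure_posterior_CDF:
  assumes meas [measurable]: "(\<lambda>w. pmf (h w) x) \<in> borel_measurable borel"
    and pos: "0 < marginal F h x"
  shows "interval_measure (posterior_CDF F f h x) =
    density (interval_measure F) (\<lambda>w. ennreal (pmf (h w) x / marginal F h x))" (is "_ = ?Q")
proof (rule interval_measure_eqI)
  have int: "integrable (interval_measure F) (\<lambda>w. pmf (h w) x / marginal F h x)"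
    using integrable_pmf_F[OF meas] by simp
  have em: "emeasure ?Q A = ennreal (LINT w|interval_measure F. indicator A w * (pmf (h w) x / marginal F h x))"
    if [measurable]: "A \<in> sets borel" for A
  proof -
    have "emeasure ?Q A =
        (\<integral>\<^sup>+ w. ennreal (indicator A w * (pmf (h w) x / marginal F h x)) \<partial>interval_measure F)"
      by (subst emeasure_density) (auto intro!: nn_integral_cong split: split_indicator)
    also have "\<dots> = ennreal (LINT w|interval_measure F. indicator A w * (pmf (h w) x / marginal F h x))"
      using pos integrable_mult_indicator[OF _ int, of A] by (intro nn_integral_eq_integral) auto
    finally show ?thesis .
  qed
  show "real_distribution ?Q"
  proof (intro real_distribution.intro prob_spaceI real_distribution_axioms.intro)
    show "emeasure ?Q (space ?Q) = 1"
      using em[of UNIV] pos by (simp add: marginal_def[symmetric])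
  qed simp
  show "posterior_CDF F f h x m = cdf ?Q m" for m
  proof -
    have "cdf ?Q m = (LINT w|interval_measure F. indicator {..m} w * (pmf (h w) x / marginal F h x))"
      using pos by (simp add: cdf_def2 measure_def em integral_nonneg_AE)
    also have "\<dots> = (LINT w|lborel. f w * (indicator {..m} w * (pmf (h w) x / marginal F h x)))"
      unfolding interval_measure_eq_density by (subst integral_real_density) (auto simp: f_nonneg)
    also have "\<dots> = posterior_CDF F f h x m"
      by (auto simp: posterior_CDF_def set_lebesgue_integral_def posterior_density_def mult_ac)
    finally show ?thesis by simp
  qed
qed

text \<open>Final wealth is a function of the signal and the state, so its law is an image of their
  joint law. The version for nonnegative integrands needs no integrability and serves both parts of
  \<open>ext_integral\<close>.\<close>

lemma nn_integral_wealth_CDF: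
  assumes exp: "is_experiment F X h"
    and \<beta> [measurable]: "\<And>x. x \<in> X \<Longrightarrow> \<beta> x \<in> borel_measurable borel"
    and g [measurable]: "g \<in> borel_measurable borel"
  shows "(\<integral>\<^sup>+ m. g m \<partial>interval_measure (wealth_CDF F f X h \<mu> \<beta>)) =
    (\<integral>\<^sup>+ w. (\<Sum>x\<in>X. ennreal (pmf (h w) x) * g (w + \<beta> x w - \<mu>)) \<partial>interval_measure F)"
proof -
  \<comment> \<open>\<open>J\<close> is the joint law of signal and state, and \<open>N\<close> its
    image under final wealth; the rest of the proof shows that \<open>N\<close> has the CDF
    \<open>wealth_CDF\<close>.\<close>
  define J where "J = density (count_space X \<Otimes>\<^sub>M interval_measure F) (\<lambda>(x, w). ennreal (pmf (h w) x))"
  define N where "N = distr J borel (\<lambda>(x, w). w + \<beta> x w - \<mu>)"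
  have X: "finite X" and h: "set_pmf (h w) \<subseteq> X" for w
    using exp unfolding is_experiment_def by auto
  have meas [measurable]: "(\<lambda>w. pmf (h w) x) \<in> borel_measurable borel"
    and pos: "0 < marginal F h x" if "x \<in> X" for x
    using exp that unfolding is_experiment_def by auto
  have T [measurable]: "(\<lambda>(x, w). w + \<beta> x w - \<mu>) \<in> borel_measurable (count_space X \<Otimes>\<^sub>M interval_measure F)"
    and H [measurable]: "(\<lambda>(x, w). ennreal (pmf (h w) x)) \<in> borel_measurable (count_space X \<Otimes>\<^sub>M interval_measure F)"
    by (rule measurable_pair_measure_countable1; use X in \<open>simp add: countable_finite; measurable\<close>)+
  have N: "(\<integral>\<^sup>+ m. g m \<partial>N) = (\<Sum>x\<in>X. \<integral>\<^sup>+ w. ennreal (pmf (h w) x) * g (w + \<beta> x w - \<mu>) \<partial>interval_measure F)"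
    if [measurable]: "g \<in> borel_measurable borel" for g
  proof -
    have "(\<integral>\<^sup>+ m. g m \<partial>N) = (\<integral>\<^sup>+ y. (\<lambda>(x, w). ennreal (pmf (h w) x)) y * g ((\<lambda>(x, w). w + \<beta> x w - \<mu>) y)
        \<partial>(count_space X \<Otimes>\<^sub>M interval_measure F))"
      unfolding N_def J_def by (subst nn_integral_distr, measurable) (subst nn_integral_density, auto)
    also have "\<dots> = (\<integral>\<^sup>+ x. \<integral>\<^sup>+ w. ennreal (pmf (h w) x) * g (w + \<beta> x w - \<mu>) \<partial>interval_measure F \<partial>count_space X)"
      by (subst F.nn_integral_fst[symmetric]) auto
    finally show ?thesis
      using X by (simp add: nn_integral_count_space_finite)
  qed
  have sum_swap: "(\<Sum>x\<in>X. \<integral>\<^sup>+ w. ennreal (pmf (h w) x) * g (w + \<beta> x w - \<mu>) \<partial>interval_measure F) =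
      (\<integral>\<^sup>+ w. (\<Sum>x\<in>X. ennreal (pmf (h w) x) * g (w + \<beta> x w - \<mu>)) \<partial>interval_measure F)"
    if [measurable]: "g \<in> borel_measurable borel" for g
    by (subst nn_integral_sum) auto
  have "emeasure N UNIV = (\<integral>\<^sup>+ w. (\<Sum>x\<in>X. ennreal (pmf (h w) x)) \<partial>interval_measure F)"
    using N[of "\<lambda>_. 1"] sum_swap[of "\<lambda>_. 1"] by (simp add: N_def)
  also have "\<dots> = (\<integral>\<^sup>+ w. 1 \<partial>interval_measure F)"
    using X h by (intro nn_integral_cong) (simp add: sum_ennreal sum_pmf_eq_1)
  finally have "emeasure N UNIV = 1"
    using F.emeasure_space_1 by simp
  then have "real_distribution N"
    by (intro real_distribution.intro prob_spaceI real_distribution_axioms.intro) (auto simp: N_def)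
  moreover have "wealth_CDF F f X h \<mu> \<beta> m = cdf N m" for m
  proof -
    \<comment> \<open>The weight \<open>marginal F h x\<close> cancels the normalisation of the
      posterior, which leaves the joint probability of signal \<open>x\<close> and wealth at most
      \<open>m\<close>.\<close>
    have *: "ennreal (marginal F h x * measure (interval_measure (posterior_CDF F f h x)) {w. w + \<beta> x w - \<mu> \<le> m}) =
        (\<integral>\<^sup>+ w. ennreal (pmf (h w) x) * indicator {..m} (w + \<beta> x w - \<mu>) \<partial>interval_measure F)" if x: "x \<in> X" for x
    proof -
      note [measurable] = \<beta>[OF x] meas[OF x]
      define Q where "Q = density (interval_measure F) (\<lambda>w. ennreal (pmf (h w) x / marginal F h x))"
      have Q: "interval_measure (posterior_CDF F f h x) = Q"
        unfolding Q_def using x by (intro interval_measure_posterior_CDF meas pos)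
      have "emeasure Q UNIV = (\<integral>\<^sup>+ w. ennreal (pmf (h w) x / marginal F h x) \<partial>interval_measure F)"
        by (simp add: Q_def emeasure_density)
      also have "\<dots> = ennreal (LINT w|interval_measure F. pmf (h w) x / marginal F h x)"
        using pos[OF x] integrable_pmf_F[OF meas[OF x]] by (intro nn_integral_eq_integral) auto
      finally have "finite_measure Q"
        by (intro finite_measureI) (simp add: Q_def)
      then have "ennreal (marginal F h x * measure Q {w. w + \<beta> x w - \<mu> \<le> m}) =
          ennreal (marginal F h x) * emeasure Q {w. w + \<beta> x w - \<mu> \<le> m}"
        using pos[OF x] by (simp add: ennreal_mult finite_measure.emeasure_eq_measure)
      also have "\<dots> = ennreal (marginal F h x) *
          (\<integral>\<^sup>+ w. ennreal (pmf (h w) x / marginal F h x) * indicator {..m} (w + \<beta> x w - \<mu>) \<partial>interval_measure F)"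
        unfolding Q_def
        by (subst emeasure_density) (auto intro!: arg_cong2[where f="(*)"] nn_integral_cong split: split_indicator)
      also have "\<dots> = (\<integral>\<^sup>+ w. ennreal (marginal F h x) *
          (ennreal (pmf (h w) x / marginal F h x) * indicator {..m} (w + \<beta> x w - \<mu>)) \<partial>interval_measure F)"
        by (subst nn_integral_cmult) auto
      also have "\<dots> = (\<integral>\<^sup>+ w. ennreal (pmf (h w) x) * indicator {..m} (w + \<beta> x w - \<mu>) \<partial>interval_measure F)"
        using pos[OF x] by (intro nn_integral_cong) (simp add: mult.assoc[symmetric] ennreal_mult[symmetric])
      finally show ?thesis by (simp add: Q)
    qed
    have "ennreal (wealth_CDF F f X h \<mu> \<beta> m) =
        (\<Sum>x\<in>X. ennreal (marginal F h x * measure (interval_measure (posterior_CDF F f h x)) {w. w + \<beta> x w - \<mu> \<le> m}))"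
      using pos by (subst sum_ennreal) (auto simp: wealth_CDF_def less_imp_le)
    also have "\<dots> = emeasure N {..m}"
      using N[of "indicator {..m}"] by (simp add: * N_def)
    finally have "cdf N m = enn2real (ennreal (wealth_CDF F f X h \<mu> \<beta> m))"
      by (simp add: cdf_def2 measure_def)
    \<comment> \<open>\<open>ennreal\<close> truncates negative numbers to 0, so nonnegativity is
      what allows the return to reals.\<close>
    moreover have "0 \<le> wealth_CDF F f X h \<mu> \<beta> m"
      using pos by (auto intro!: sum_nonneg simp: wealth_CDF_def less_imp_le)
    ultimately show ?thesis by simp
  qed
  ultimately have "interval_measure (wealth_CDF F f X h \<mu> \<beta>) = N"
    by (rule interval_measure_eqI)
  then show ?thesis
    using N[OF g] sum_swap[OF g] by simp
qed

text \<open>The formula for nonnegative integrands, applied to \<open>u\<close> and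
  \<open>-u\<close>; integrability makes both results finite and their difference
  recombines.\<close>

lemma ext_integral_wealth_CDF:
  assumes exp: "is_experiment F X h"
    and \<beta>: "\<And>x. x \<in> X \<Longrightarrow> \<beta> x \<in> borel_measurable borel"
    and u: "u \<in> borel_measurable borel"
    and int: "\<And>x. x \<in> X \<Longrightarrow> F_integrable F (\<lambda>w. u (w + \<beta> x w - \<mu>))"
  shows "ext_integral (interval_measure (wealth_CDF F f X h \<mu> \<beta>)) u =
    ereal (LINT w|interval_measure F. (\<Sum>x\<in>X. pmf (h w) x * u (w + \<beta> x w - \<mu>)))"
proof -
  have X: "finite X" and meas: "(\<lambda>w. pmf (h w) x) \<in> borel_measurable borel" if "x \<in> X" for x
    using exp that unfolding is_experiment_def by auto
  \<comment> \<open>Only \<open>s = 1\<close> and \<open>s = -1\<close> are used, for the positive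
    and the negative part; \<open>max 0\<close> makes the truncation by \<open>ennreal\<close>
    explicit.\<close>
  have nn: "(\<integral>\<^sup>+ m. ennreal (s * u m) \<partial>interval_measure (wealth_CDF F f X h \<mu> \<beta>)) =
      ennreal (LINT w|interval_measure F. (\<Sum>x\<in>X. pmf (h w) x * max 0 (s * u (w + \<beta> x w - \<mu>))))"
     (is "?L = _") and
    intg: "integrable (interval_measure F) (\<lambda>w. \<Sum>x\<in>X. pmf (h w) x * max 0 (s * u (w + \<beta> x w - \<mu>)))" for s
  proof -
    have *: "integrable (interval_measure F) (\<lambda>w. pmf (h w) x * max 0 (s * u (w + \<beta> x w - \<mu>)))"
      if "x \<in> X" for x
    proof (rule Bochner_Integration.integrable_bound)
      show i: "integrable (interval_measure F) (\<lambda>w. s * u (w + \<beta> x w - \<mu>))"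
        using int[OF that] by simp
      show "(\<lambda>w. pmf (h w) x * max 0 (s * u (w + \<beta> x w - \<mu>))) \<in> borel_measurable (interval_measure F)"
        using meas[OF that] borel_measurable_integrable[OF int[OF that]]
        by (intro borel_measurable_times borel_measurable_max) auto
      have "pmf (h w) x * max 0 y \<le> \<bar>y\<bar>" for w and y :: real
        using mult_left_le_one_le[of "max 0 y" "pmf (h w) x"] by (auto simp: pmf_le_1)
      then show "AE w in interval_measure F. norm (pmf (h w) x * max 0 (s * u (w + \<beta> x w - \<mu>))) \<le> norm (s * u (w + \<beta> x w - \<mu>))"
        by simp
    qed
    then show int': "integrable (interval_measure F) (\<lambda>w. \<Sum>x\<in>X. pmf (h w) x * max 0 (s * u (w + \<beta> x w - \<mu>)))"
      by simp
    have "?L = (\<integral>\<^sup>+ w. (\<Sum>x\<in>X. ennreal (pmf (h w) x) * ennreal (s * u (w + \<beta> x w - \<mu>))) \<partial>interval_measure F)"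
      using u by (intro nn_integral_wealth_CDF[OF exp \<beta>]) auto
    also have "\<dots> = (\<integral>\<^sup>+ w. ennreal (\<Sum>x\<in>X. pmf (h w) x * max 0 (s * u (w + \<beta> x w - \<mu>))) \<partial>interval_measure F)"
    proof (intro nn_integral_cong)
      have "ennreal p * ennreal y = ennreal (p * max 0 y)" if "0 \<le> p" for p y
        using that by (auto simp: max_def ennreal_mult ennreal_neg)
      then show "(\<Sum>x\<in>X. ennreal (pmf (h w) x) * ennreal (s * u (w + \<beta> x w - \<mu>))) =
          ennreal (\<Sum>x\<in>X. pmf (h w) x * max 0 (s * u (w + \<beta> x w - \<mu>)))" for w
        by (subst sum_ennreal[symmetric]) simp_all
    qed
    also have "\<dots> = ennreal (LINT w|interval_measure F. (\<Sum>x\<in>X. pmf (h w) x * max 0 (s * u (w + \<beta> x w - \<mu>))))"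
      using int' by (intro nn_integral_eq_integral) (auto intro!: sum_nonneg)
    finally show "?L = \<dots>" .
  qed
  have "ext_integral (interval_measure (wealth_CDF F f X h \<mu> \<beta>)) u =
     ereal (LINT w|interval_measure F. (\<Sum>x\<in>X. pmf (h w) x * max 0 (1 * u (w + \<beta> x w - \<mu>)))) -
     ereal (LINT w|interval_measure F. (\<Sum>x\<in>X. pmf (h w) x * max 0 (- 1 * u (w + \<beta> x w - \<mu>))))"
    unfolding ext_integral_def using nn[of 1] nn[of "-1"] by (auto simp: integral_nonneg_AE sum_nonneg)
  also have "\<dots> = ereal (LINT w|interval_measure F. (\<Sum>x\<in>X. pmf (h w) x * max 0 (1 * u (w + \<beta> x w - \<mu>))) -
     (\<Sum>x\<in>X. pmf (h w) x * max 0 (- 1 * u (w + \<beta> x w - \<mu>))))"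
    by (simp only: Bochner_Integration.integral_diff[OF intg intg] ereal_minus(1))
  also have "(\<lambda>w. (\<Sum>x\<in>X. pmf (h w) x * max 0 (1 * u (w + \<beta> x w - \<mu>))) -
     (\<Sum>x\<in>X. pmf (h w) x * max 0 (- 1 * u (w + \<beta> x w - \<mu>)))) =
     (\<lambda>w. \<Sum>x\<in>X. pmf (h w) x * u (w + \<beta> x w - \<mu>))" (is "?l = ?r")
  proof
    have "p * max 0 (1 * y) - p * max 0 (- 1 * y) = p * y" for p y :: real
      by (simp add: max_def)
    then show "?l w = ?r w" for w
      by (simp only: sum_subtractf[symmetric])
  qed
  finally show ?thesis .
qed

end

section \<open>Willingness to pay\<close>

text \<open>There are finitely many strategies, so the maximum exists and \<open>GREATEST\<close>
  denotes it.\<close>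

lemma max_expected_utility_eq_Max:
  assumes "finite X" "finite B" "B \<noteq> {}"
  shows "max_expected_utility F f B X h u \<mu> =
    Max ((\<lambda>\<beta>. ext_integral (interval_measure (wealth_CDF F f X h \<mu> \<beta>)) u) ` (X \<rightarrow>\<^sub>E B))"
    (is "_ = Max (?V ` ?S)")
proof -
  have S: "finite (?V ` ?S)" "?V ` ?S \<noteq> {}"
    using assms by (auto intro: finite_PiE simp: PiE_eq_empty_iff)
  have "max_expected_utility F f B X h u \<mu> = (GREATEST e. e \<in> ?V ` ?S)"
    unfolding max_expected_utility_def by (auto simp: image_iff intro!: arg_cong[where f=Greatest])
  also have "\<dots> = Max (?V ` ?S)"
    using S by (intro Greatest_equality) auto
  finally show ?thesis .
qed

text \<open>A fee at which the best strategy exactly breaks even is the willingness to pay, since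
  every strategy loses value strictly as the fee rises.\<close>

lemma is_willingness_to_payI:
  assumes fin: "finite X" "finite B" "B \<noteq> {}"
    and V: "\<And>\<beta> \<mu>. \<beta> \<in> X \<rightarrow>\<^sub>E B \<Longrightarrow>
      ext_integral (interval_measure (wealth_CDF F f X h \<mu> \<beta>)) u = ereal (V \<beta> \<mu>)"
    and decr: "\<And>\<beta> \<mu> \<mu>'. \<beta> \<in> X \<rightarrow>\<^sub>E B \<Longrightarrow> \<mu> < \<mu>' \<Longrightarrow> V \<beta> \<mu>' < V \<beta> \<mu>"
    and M: "0 \<le> M" "\<And>\<beta>. \<beta> \<in> X \<rightarrow>\<^sub>E B \<Longrightarrow> V \<beta> M \<le> (LINT w|interval_measure F. u w)"
    and \<beta>: "\<beta> \<in> X \<rightarrow>\<^sub>E B" "V \<beta> M = (LINT w|interval_measure F. u w)"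
  shows "is_willingness_to_pay F f B X h u M"
proof -
  have S: "finite (X \<rightarrow>\<^sub>E B)" "X \<rightarrow>\<^sub>E B \<noteq> {}"
    using fin by (auto intro: finite_PiE simp: PiE_eq_empty_iff)
  have max: "max_expected_utility F f B X h u \<mu> = Max ((\<lambda>\<beta>. ereal (V \<beta> \<mu>)) ` (X \<rightarrow>\<^sub>E B))" for \<mu>
    by (auto simp: max_expected_utility_eq_Max[OF fin] V intro!: arg_cong[where f=Max])
  have "V \<gamma> \<mu> < (LINT w|interval_measure F. u w)" if "\<gamma> \<in> X \<rightarrow>\<^sub>E B" "M < \<mu>" for \<gamma> \<mu>
    using decr[OF that] M(2)[OF that(1)] by simp
  moreover have "(LINT w|interval_measure F. u w) < V \<beta> \<mu>" if "\<mu> < M" for \<mu>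
    using decr[OF \<beta>(1) that] \<beta>(2) by simp
  ultimately show ?thesis
    using S M(1) \<beta>(1) unfolding is_willingness_to_pay_def max by (auto simp: Max_gr_iff intro!: bexI[of _ \<beta>])
qed

lemma willingness_to_pay_eqI:
  assumes "is_willingness_to_pay F f B X h u M"
  shows "willingness_to_pay F f B X h u = M"
  unfolding willingness_to_pay_def
  using assms is_willingness_to_pay_unique by (intro the_equality)

text \<open>By the intermediate value theorem, each strategy that is no worse than the status quo at
  fee 0 has a break-even fee. The largest of these is the willingness to pay, and it stays below
  \<open>\<mu>\<^sub>1\<close>, where every strategy is strictly worse than the status quo.\<close>

lemma ex_is_willingness_to_pay_less:
  assumes fin: "finite X" "finite B" "B \<noteq> {}"
    and V: "\<And>\<beta> \<mu>. \<beta> \<in> X \<rightarrow>\<^sub>E B \<Longrightarrow>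
      ext_integral (interval_measure (wealth_CDF F f X h \<mu> \<beta>)) u = ereal (V \<beta> \<mu>)"
    and decr: "\<And>\<beta> \<mu> \<mu>'. \<beta> \<in> X \<rightarrow>\<^sub>E B \<Longrightarrow> \<mu> < \<mu>' \<Longrightarrow> V \<beta> \<mu>' < V \<beta> \<mu>"
    and cont: "\<And>\<beta>. \<beta> \<in> X \<rightarrow>\<^sub>E B \<Longrightarrow> continuous_on UNIV (V \<beta>)"
    and less: "0 \<le> \<mu>\<^sub>1" "\<And>\<beta>. \<beta> \<in> X \<rightarrow>\<^sub>E B \<Longrightarrow> V \<beta> \<mu>\<^sub>1 < (LINT w|interval_measure F. u w)"
    and \<beta>: "\<beta> \<in> X \<rightarrow>\<^sub>E B" "(LINT w|interval_measure F. u w) \<le> V \<beta> 0"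
  shows "\<exists>M<\<mu>\<^sub>1. is_willingness_to_pay F f B X h u M"
proof -
  define e where "e = (LINT w|interval_measure F. u w)"
  \<comment> \<open>These are the strategies with a break-even fee that is nonnegative. All others
    are below \<open>e\<close> at every nonnegative fee.\<close>
  define S where "S = {\<beta> \<in> X \<rightarrow>\<^sub>E B. e \<le> V \<beta> 0}"
  have "\<exists>m. 0 \<le> m \<and> m \<le> \<mu>\<^sub>1 \<and> V \<gamma> m = e" if "\<gamma> \<in> S" for \<gamma>
    using that less cont[of \<gamma>]
    by (intro IVT2') (auto simp: S_def e_def less_imp_le intro: continuous_on_subset)
  then obtain m where m: "\<And>\<gamma>. \<gamma> \<in> S \<Longrightarrow> 0 \<le> m \<gamma> \<and> m \<gamma> \<le> \<mu>\<^sub>1 \<and> V \<gamma> (m \<gamma>) = e"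
    by metis
  have S: "finite (m ` S)" "m ` S \<noteq> {}"
    using fin \<beta> by (auto simp: S_def e_def intro!: finite_imageI finite_PiE)
  from Max_in[OF this] obtain \<gamma> where \<gamma>: "\<gamma> \<in> S" "Max (m ` S) = m \<gamma>"
    by auto
  have mono: "V \<beta> \<mu>' \<le> V \<beta> \<mu>" if "\<beta> \<in> X \<rightarrow>\<^sub>E B" "\<mu> \<le> \<mu>'" for \<beta> \<mu> \<mu>'
    using decr[OF that(1), of \<mu> \<mu>'] that(2) by (cases "\<mu> = \<mu>'") auto
  have \<gamma>': "\<gamma> \<in> X \<rightarrow>\<^sub>E B"
    using \<gamma>(1) by (simp add: S_def)
  have "V \<beta> (m \<gamma>) \<le> e" if "\<beta> \<in> X \<rightarrow>\<^sub>E B" for \<beta>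
  proof (cases "\<beta> \<in> S")
    case True
    then have "m \<beta> \<le> m \<gamma>"
      using S(1) by (simp flip: \<gamma>(2))
    with mono[OF that this] m[OF True] show ?thesis by simp
  next
    case False
    then have "V \<beta> 0 < e"
      using that by (simp add: S_def)
    with mono[OF that, of 0 "m \<gamma>"] m[OF \<gamma>(1)] show ?thesis by simp
  qed
  then have "is_willingness_to_pay F f B X h u (m \<gamma>)"
    using m[OF \<gamma>(1)] \<gamma>'
    by (intro is_willingness_to_payI[where V=V and \<beta>=\<gamma>] fin V decr) (auto simp: e_def)
  moreover have "m \<gamma> < \<mu>\<^sub>1"
    using m[OF \<gamma>(1)] less(2)[OF \<gamma>'] by (cases "m \<gamma> = \<mu>\<^sub>1") (auto simp: e_def)
  ultimately show ?thesis by blast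
qed

section \<open>Lipschitz functions as utilities\<close>

lemma lipschitz_id: "1-lipschitz_on UNIV (\<lambda>w::real. w)"
  by (rule lipschitz_onI) auto

lemma lipschitz_on_imp_abs_continuous_between:
  assumes "L-lipschitz_on UNIV u"
  shows "abs_continuous_between u a b"
  unfolding abs_continuous_between_def
proof (intro allI impI)
  fix \<epsilon> :: real assume "0 < \<epsilon>"
  have L: "0 \<le> L" and u: "\<bar>u x - u y\<bar> \<le> L * \<bar>x - y\<bar>" for x y
    using assms by (auto simp: lipschitz_on_def dist_real_def)
  show "\<exists>\<delta>>0. \<forall>(n::nat) c d. (\<forall>i<n. a \<le> c i \<and> c i \<le> d i \<and> d i \<le> b) \<and>
      disjoint_family_on (\<lambda>i. {c i<..<d i}) {..<n} \<and> (\<Sum>i<n. d i - c i) < \<delta> \<longrightarrow>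
      (\<Sum>i<n. \<bar>u (d i) - u (c i)\<bar>) < \<epsilon>"
  \<comment> \<open>The summand 1 keeps the denominator positive when \<open>L = 0\<close>.\<close>
  proof (intro exI[of _ "\<epsilon> / (L + 1)"] conjI allI impI)
    show "0 < \<epsilon> / (L + 1)"
      using \<open>0 < \<epsilon>\<close> L by simp
    fix n :: nat and c d :: "nat \<Rightarrow> real"
    assume *: "(\<forall>i<n. a \<le> c i \<and> c i \<le> d i \<and> d i \<le> b) \<and>
      disjoint_family_on (\<lambda>i. {c i<..<d i}) {..<n} \<and> (\<Sum>i<n. d i - c i) < \<epsilon> / (L + 1)"
    have "(\<Sum>i<n. \<bar>u (d i) - u (c i)\<bar>) \<le> (\<Sum>i<n. L * (d i - c i))"
      using * u by (intro sum_mono) (smt (verit, ccfv_SIG) lessThan_iff)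
    also have "\<dots> \<le> (L + 1) * (\<Sum>i<n. d i - c i)"
      using * by (auto simp: sum_distrib_left[symmetric] intro!: mult_right_mono sum_nonneg)
    also have "\<dots> < \<epsilon>"
      using * L by (simp add: field_simps)
    finally show "(\<Sum>i<n. \<bar>u (d i) - u (c i)\<bar>) < \<epsilon>" .
  qed
qed

text \<open>Linear growth: \<open>u (g w)\<close> is dominated by
  \<open>\<bar>u 0\<bar> + L * \<bar>g w\<bar>\<close>, and constants are integrable for a finite
  measure.\<close>

lemma lipschitz_on_imp_integrable:
  fixes u :: "real \<Rightarrow> real"
  assumes u: "L-lipschitz_on UNIV u" and "finite_measure M" and g: "integrable M g"
  shows "integrable M (\<lambda>w. u (g w))"
proof -
  interpret finite_measure M by fact
  have L: "0 \<le> L" and bound: "\<bar>u x - u y\<bar> \<le> L * \<bar>x - y\<bar>" for x y :: real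
    using u by (auto simp: lipschitz_on_def dist_real_def)
  have [measurable]: "u \<in> borel_measurable borel"
    using lipschitz_on_continuous_on[OF u] by (rule borel_measurable_continuous_onI)
  show ?thesis
  proof (rule Bochner_Integration.integrable_bound)
    show "integrable M (\<lambda>w. \<bar>u 0\<bar> + L * \<bar>g w\<bar>)"
      using g by simp
    show "(\<lambda>w. u (g w)) \<in> borel_measurable M"
      using g by (auto intro: measurable_compose[OF borel_measurable_integrable])
    have "\<bar>u (g w)\<bar> \<le> \<bar>u 0\<bar> + L * \<bar>g w\<bar>" for w
      using bound[of "g w" 0] by simp
    then show "AE w in M. norm (u (g w)) \<le> norm (\<bar>u 0\<bar> + L * \<bar>g w\<bar>)"
      using L by simp
  qed
qed

lemma lipschitz_on_imp_utility:
  assumes u: "L-lipschitz_on UNIV u" and "strict_mono u"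
    and "finite_measure (interval_measure F)" "F_integrable F (\<lambda>w. w)"
  shows "u \<in> utilities F"
proof -
  have "0 \<le> L" and bound: "\<bar>u x - u y\<bar> \<le> L * \<bar>x - y\<bar>" for x y
    using u by (auto simp: lipschitz_on_def dist_real_def)
  \<comment> \<open>The limsup condition concerns large \<open>m\<close> only, and \<open>m\<close>
    at least 1 lets the constant \<open>\<bar>u 0\<bar>\<close> be absorbed into the slope.\<close>
  have "u m / m \<le> \<bar>u 0\<bar> + L" if "1 \<le> m" for m
  proof -
    have "u m \<le> \<bar>u 0\<bar> * 1 + L * m"
      using bound[of m 0] that abs_ge_self[of "u m - u 0"] abs_ge_self[of "u 0"] by simp
    also have "\<dots> \<le> \<bar>u 0\<bar> * m + L * m"
      using that by (intro add_mono mult_left_mono order_refl) auto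
    finally show ?thesis
      using that by (simp add: field_simps)
  qed
  then have "\<forall>\<^sub>F m in at_top. ereal (u m / m) \<le> ereal (\<bar>u 0\<bar> + L)"
    by (auto intro: eventually_mono[OF eventually_ge_at_top[of 1]])
  then have "Limsup at_top (\<lambda>m. ereal (u m / m)) \<le> ereal (\<bar>u 0\<bar> + L)"
    by (rule Limsup_bounded)
  then have "Limsup at_top (\<lambda>m. ereal (u m / m)) < \<infinity>"
    by (auto intro: le_less_trans)
  moreover have "F_integrable F u"
    by (rule lipschitz_on_imp_integrable[OF u assms(3,4)])
  ultimately show ?thesis
    using \<open>strict_mono u\<close> lipschitz_on_imp_abs_continuous_between[OF u]
    unfolding utilities_def by blast
qed

section \<open>Expected utility as a function of the fee\<close>

context density_environment
begin

text \<open>A real-valued integral over states under the prior instead of over wealth; dependence on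
  the fee can be read off its integrand. For Lipschitz utilities and integrable assets it is shown
  below to agree with the integral against \<open>wealth_CDF\<close>.\<close>

definition expected_utility where
  "expected_utility X h u \<beta> \<mu> =
     (LINT w|interval_measure F. (\<Sum>x\<in>X. pmf (h w) x * u (w + \<beta> x w - \<mu>)))"

context
  fixes X :: "real set" and h :: "real \<Rightarrow> real pmf" and \<beta> :: "real \<Rightarrow> real \<Rightarrow> real"
    and u :: "real \<Rightarrow> real" and L :: real
  assumes exp: "is_experiment F X h"
    and mean: "F_integrable F (\<lambda>w. w)"
    and \<beta>: "\<And>x. x \<in> X \<Longrightarrow> \<beta> x \<in> borel_measurable borel" "\<And>x. x \<in> X \<Longrightarrow> F_integrable F (\<beta> x)"
    and u: "L-lipschitz_on UNIV u"
begin

lemma pmf_measurable: "x \<in> X \<Longrightarrow> (\<lambda>w. pmf (h w) x) \<in> borel_measurable borel"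
  using exp unfolding is_experiment_def by blast

lemma u_measurable: "u \<in> borel_measurable borel"
  using lipschitz_on_continuous_on[OF u] by (rule borel_measurable_continuous_onI)

lemma integrable_utility:
  "x \<in> X \<Longrightarrow> F_integrable F (\<lambda>w. u (w + \<beta> x w - \<mu>))"
  using \<beta>(2) mean
  by (intro lipschitz_on_imp_integrable[OF u F.finite_measure_axioms] Bochner_Integration.integrable_diff
      Bochner_Integration.integrable_add) auto

lemma integrable_ex_post_utility:
  "F_integrable F (\<lambda>w. (\<Sum>x\<in>X. pmf (h w) x * u (w + \<beta> x w - \<mu>)))"
proof (rule Bochner_Integration.integrable_sum, rule Bochner_Integration.integrable_bound)
  fix x assume x: "x \<in> X"
  show "integrable (interval_measure F) (\<lambda>w. u (w + \<beta> x w - \<mu>))"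
    by (rule integrable_utility[OF x])
  show "(\<lambda>w. pmf (h w) x * u (w + \<beta> x w - \<mu>)) \<in> borel_measurable (interval_measure F)"
    using pmf_measurable[OF x] borel_measurable_integrable[OF integrable_utility[OF x]]
    by (intro borel_measurable_times) (simp_all cong: measurable_cong_sets)
  show "AE w in interval_measure F. norm (pmf (h w) x * u (w + \<beta> x w - \<mu>)) \<le> norm (u (w + \<beta> x w - \<mu>))"
    by (simp add: abs_mult pmf_le_1 mult_left_le_one_le)
qed

lemma ext_integral_wealth_CDF_eq_expected_utility:
  "ext_integral (interval_measure (wealth_CDF F f X h \<mu> \<beta>)) u = ereal (expected_utility X h u \<beta> \<mu>)"
  unfolding expected_utility_def
  by (rule ext_integral_wealth_CDF[OF exp \<beta>(1) u_measurable integrable_utility])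

lemma sum_pmf_experiment: "(\<Sum>x\<in>X. pmf (h w) x) = 1"
  using exp by (intro sum_pmf_eq_1) (auto simp: is_experiment_def)

lemma expected_utility_strict_decreasing:
  assumes "strict_mono u" "\<mu> < \<mu>'"
  shows "expected_utility X h u \<beta> \<mu>' < expected_utility X h u \<beta> \<mu>"
proof -
  have "(\<Sum>x\<in>X. pmf (h w) x * u (w + \<beta> x w - \<mu>')) < (\<Sum>x\<in>X. pmf (h w) x * u (w + \<beta> x w - \<mu>))" for w
  proof (rule sum_strict_mono_ex1)
    have lt: "u (w + \<beta> x w - \<mu>') < u (w + \<beta> x w - \<mu>)" for x
      using assms by (simp add: strict_mono_less)
    then show "\<forall>x\<in>X. pmf (h w) x * u (w + \<beta> x w - \<mu>') \<le> pmf (h w) x * u (w + \<beta> x w - \<mu>)"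
      by (simp add: less_imp_le mult_left_mono)
    \<comment> \<open>Strictness in each state needs one signal of positive probability
      there.\<close>
    obtain x where "x \<in> X" "pmf (h w) x \<noteq> 0"
      using sum_pmf_experiment[of w] by (metis sum.neutral zero_neq_one)
    then show "\<exists>x\<in>X. pmf (h w) x * u (w + \<beta> x w - \<mu>') < pmf (h w) x * u (w + \<beta> x w - \<mu>)"
      using lt[of x] by (intro bexI[of _ x] mult_strict_left_mono) (auto simp: less_le)
  qed (use exp in \<open>simp add: is_experiment_def\<close>)
  then show ?thesis
    unfolding expected_utility_def
    by (intro F.integral_less_AE_space integrable_ex_post_utility) (use F.emeasure_space_1 in auto)
qed

text \<open>The Lipschitz constant of \<open>u\<close> carries over to the fee, because the signal
  probabilities in each state sum to 1.\<close>

lemma continuous_on_expected_utility: "continuous_on UNIV (expected_utility X h u \<beta>)"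
proof (rule lipschitz_on_continuous_on)
  have L: "0 \<le> L" and bound: "\<bar>u x - u y\<bar> \<le> L * \<bar>x - y\<bar>" for x y :: real
    using u by (auto simp: lipschitz_on_def dist_real_def)
  show "L-lipschitz_on UNIV (expected_utility X h u \<beta>)"
  proof (rule lipschitz_onI)
    fix \<mu> \<mu>'
    let ?d = "\<lambda>w. (\<Sum>x\<in>X. pmf (h w) x * u (w + \<beta> x w - \<mu>)) - (\<Sum>x\<in>X. pmf (h w) x * u (w + \<beta> x w - \<mu>'))"
    have int: "F_integrable F ?d"
      by (intro Bochner_Integration.integrable_diff integrable_ex_post_utility)
    have "\<bar>?d w\<bar> \<le> L * \<bar>\<mu> - \<mu>'\<bar>" for w
    proof -
      have "\<bar>?d w\<bar> = \<bar>\<Sum>x\<in>X. pmf (h w) x * (u (w + \<beta> x w - \<mu>) - u (w + \<beta> x w - \<mu>'))\<bar>"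
        by (simp add: sum_subtractf right_diff_distrib)
      also have "\<dots> \<le> (\<Sum>x\<in>X. pmf (h w) x * (L * \<bar>\<mu> - \<mu>'\<bar>))"
        using bound[of "w + \<beta> x w - \<mu>" "w + \<beta> x w - \<mu>'" for x]
        by (intro order.trans[OF sum_abs] sum_mono) (auto simp: abs_mult abs_minus_commute intro!: mult_left_mono)
      also have "\<dots> = L * \<bar>\<mu> - \<mu>'\<bar>"
        by (simp add: sum_distrib_right[symmetric] sum_pmf_experiment)
      finally show ?thesis .
    qed
    then have "(LINT w|interval_measure F. \<bar>?d w\<bar>) \<le> L * \<bar>\<mu> - \<mu>'\<bar>"
      using int by (intro F.integral_le_const) auto
    then have "\<bar>LINT w|interval_measure F. ?d w\<bar> \<le> L * \<bar>\<mu> - \<mu>'\<bar>"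
      using integral_abs_bound[of "interval_measure F" ?d] by linarith
    then show "dist (expected_utility X h u \<beta> \<mu>) (expected_utility X h u \<beta> \<mu>') \<le> L * dist \<mu> \<mu>'"
      by (simp only: expected_utility_def dist_real_def
          Bochner_Integration.integral_diff[OF integrable_ex_post_utility integrable_ex_post_utility])
  qed (rule L)
qed

end

subsection \<open>Put options on the left tail\<close>

lemma integral_F:
  assumes "g \<in> borel_measurable borel"
  shows "(LINT w|interval_measure F. g w) = (LINT w|lborel. f w * g w)"
  unfolding interval_measure_eq_density
  using assms by (subst integral_real_density) (auto simp: f_nonneg)

lemma integrable_F:
  assumes "g \<in> borel_measurable borel"
  shows "F_integrable F g \<longleftrightarrow> integrable lborel (\<lambda>w. f w * g w)"
  unfolding interval_measure_eq_density
  using assms by (subst integrable_real_density) (auto simp: f_nonneg)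

lemma integrable_put:
  assumes "F_integrable F (\<lambda>w. w)"
  shows "F_integrable F (\<lambda>w. max 0 (k - w))"
  using assms by (intro integrable_max) auto

text \<open>A worthless put would force \<open>f\<close> to vanish almost everywhere below the
  strike, against its positivity on the left tail.\<close>

lemma integral_put_pos:
  assumes tail: "super_exponential_left_tail f" and mean: "F_integrable F (\<lambda>w. w)"
  shows "0 < (LINT w|interval_measure F. max 0 (k - w))"
proof -
  obtain \<omega> where \<omega>: "\<And>w. w < \<omega> \<Longrightarrow> 0 < f w"
    using tail unfolding super_exponential_left_tail_def by auto
  \<comment> \<open>Below \<open>m\<close> both the put payoff and the density are positive, so an
    interval of length 1 ending at \<open>m\<close> would have to be null.\<close>
  define m where "m = min k \<omega>"
  have "(LINT w|interval_measure F. max 0 (k - w)) \<noteq> 0"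
  proof
    assume "(LINT w|interval_measure F. max 0 (k - w)) = 0"
    then have "AE w in interval_measure F. max 0 (k - w) = 0"
      using integral_nonneg_eq_0_iff_AE[OF integrable_put[OF mean, of k]] by simp
    then have "AE w in lborel. 0 < f w \<longrightarrow> max 0 (k - w) = 0"
      unfolding interval_measure_eq_density by (subst (asm) AE_density) auto
    then have "AE w in lborel. w \<notin> {m - 1<..<m}"
      by eventually_elim (use \<omega> in \<open>auto simp: m_def max_def split: if_splits\<close>)
    then have "emeasure lborel {m - 1<..<m} = 0"
      by (subst (asm) AE_iff_measurable[where N="{m - 1<..<m}"]) auto
    then show False by simp
  qed
  then show ?thesis
    by (simp add: less_le integral_nonneg_AE)
qed

text \<open>A shift by \<open>\<delta>\<close> multiplies the density far out in the left tail by an arbitrarily large factor,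
  and a put option value is linear in the density.\<close>

lemma put_growth:
  assumes tail: "super_exponential_left_tail f" and mean: "F_integrable F (\<lambda>w. w)"
    and "0 < \<delta>" "0 \<le> a"
  shows "\<exists>k. a * (LINT w|interval_measure F. max 0 (k - w))
    < (LINT w|interval_measure F. max 0 (k + \<delta> - w))"
proof -
  obtain \<omega> where C1: "f C1_differentiable_on {..<\<omega>}" and pos: "\<And>w. w < \<omega> \<Longrightarrow> 0 < f w"
      and lim: "filterlim (deriv (\<lambda>w. ln (f w))) at_top at_bot"
    using tail unfolding super_exponential_left_tail_def by auto
  \<comment> \<open>With slope at least \<open>A\<close>, \<open>ln f\<close> gains at least
    \<open>ln (a + 1)\<close> over a distance \<open>\<delta>\<close>. The factor
    \<open>a + 1\<close> instead of \<open>a\<close> gives the strict inequality at the end, by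
    positivity of the put value.\<close>
  define A where "A = ln (a + 1) / \<delta>"
  obtain K where K: "\<And>w. w \<le> K \<Longrightarrow> A \<le> deriv (\<lambda>w. ln (f w)) w"
    using lim unfolding filterlim_at_top eventually_at_bot_linorder by blast
  \<comment> \<open>For \<open>w < k\<close> the whole interval from \<open>w\<close> to
    \<open>w + \<delta>\<close> lies below \<open>\<omega>\<close>, where \<open>f\<close> is
    positive and differentiable, and below \<open>K\<close>, where the slope bound holds.\<close>
  define k where "k = min K (\<omega> - 1) - \<delta>"
  have f_shift: "(a + 1) * f w \<le> f (w + \<delta>)" if "w < k" for w
  proof -
    have "\<exists>z. w < z \<and> z < w + \<delta> \<and> ln (f (w + \<delta>)) - ln (f w) = (w + \<delta> - w) * deriv (\<lambda>w. ln (f w)) z"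
    proof (rule MVT2)
      fix x assume "w \<le> x" "x \<le> w + \<delta>"
      then have x: "x < \<omega>" using that by (simp add: k_def)
      then obtain D where "(f has_real_derivative D) (at x)"
        using C1 by (auto simp: C1_differentiable_on_def has_real_derivative_iff_has_vector_derivative)
      then have "((\<lambda>w. ln (f w)) has_real_derivative D / f x) (at x)"
        using pos[OF x] by (auto intro!: derivative_eq_intros)
      then show "((\<lambda>w. ln (f w)) has_real_derivative deriv (\<lambda>w. ln (f w)) x) (at x)"
        by (simp add: DERIV_imp_deriv)
    qed (use \<open>0 < \<delta>\<close> in simp)
    then obtain z where z: "w < z" "z < w + \<delta>" "ln (f (w + \<delta>)) - ln (f w) = \<delta> * deriv (\<lambda>w. ln (f w)) z"
      by auto
    have f_pos: "0 < f w" "0 < f (w + \<delta>)"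
      using that \<open>0 < \<delta>\<close> by (auto intro!: pos simp: k_def)
    have "ln (a + 1) = \<delta> * A"
      using \<open>0 < \<delta>\<close> by (simp add: A_def)
    also have "\<dots> \<le> ln (f (w + \<delta>)) - ln (f w)"
      using z K[of z] that \<open>0 < \<delta>\<close> by (simp add: k_def)
    finally have "ln ((a + 1) * f w) \<le> ln (f (w + \<delta>))"
      using f_pos \<open>0 \<le> a\<close> by (simp add: ln_mult)
    then show ?thesis
      using f_pos \<open>0 \<le> a\<close> by (subst (asm) ln_le_cancel_iff) auto
  qed
  let ?\<Phi> = "\<lambda>k. LINT w|interval_measure F. max 0 (k - w)"
  have int: "integrable lborel (\<lambda>w. f w * max 0 (k - w))" for k
    using integrable_put[OF mean, of k] by (subst (asm) integrable_F) auto
  have "(a + 1) * ?\<Phi> k = (LINT w|lborel. (a + 1) * (f w * max 0 (k - w)))"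
    by (subst integral_F) auto
  \<comment> \<open>The form \<open>\<delta> + 1 * w\<close> is that of an affine substitution with
    slope 1, which the next step undoes.\<close>
  also have "\<dots> \<le> (LINT w|lborel. f (\<delta> + 1 * w) * max 0 (k + \<delta> - (\<delta> + 1 * w)))"
  proof (rule integral_mono)
    show "integrable lborel (\<lambda>w. (a + 1) * (f w * max 0 (k - w)))"
      using int by simp
    show "integrable lborel (\<lambda>w. f (\<delta> + 1 * w) * max 0 (k + \<delta> - (\<delta> + 1 * w)))"
      by (rule lborel_integrable_real_affine[OF int]) simp
    show "(a + 1) * (f w * max 0 (k - w)) \<le> f (\<delta> + 1 * w) * max 0 (k + \<delta> - (\<delta> + 1 * w))" for w
    proof (cases "w < k")
      case True
      with f_shift[OF this] show ?thesis
        by (simp add: mult.assoc[symmetric] add.commute mult_right_mono)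
    qed simp
  qed
  also have "\<dots> = (LINT w|lborel. f w * max 0 (k + \<delta> - w))"
    by (subst lborel_integral_real_affine[of 1 _ \<delta>]) auto
  also have "\<dots> = ?\<Phi> (k + \<delta>)"
    by (subst integral_F) auto
  finally have "(a + 1) * ?\<Phi> k \<le> ?\<Phi> (k + \<delta>)" .
  moreover have "0 < ?\<Phi> k"
    by (rule integral_put_pos[OF tail mean])
  ultimately show ?thesis
    by (intro exI[of _ k]) (simp add: algebra_simps)
qed

end

section \<open>The counterexample\<close>

text \<open>The slope is \<open>1 + t\<close> below \<open>k\<close> and 1 above it. The subtracted
  term is the payoff of \<open>t\<close> puts with strike \<open>k\<close>, so its mean is
  controlled by put values.\<close>

definition kinked :: "real \<Rightarrow> real \<Rightarrow> real \<Rightarrow> real" where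
  "kinked t k w = w - t * max 0 (k - w)"

lemma kinked_le: "0 \<le> t \<Longrightarrow> kinked t k w \<le> w"
  by (simp add: kinked_def)

lemma strict_mono_kinked:
  assumes "0 \<le> t"
  shows "strict_mono (kinked t k)"
proof (rule strict_monoI)
  fix x y :: real assume "x < y"
  then have "t * max 0 (k - y) \<le> t * max 0 (k - x)"
    using assms by (intro mult_left_mono) auto
  then show "kinked t k x < kinked t k y"
    using \<open>x < y\<close> by (simp add: kinked_def)
qed

lemma lipschitz_on_kinked:
  assumes "0 \<le> t"
  shows "(1 + t)-lipschitz_on UNIV (kinked t k)"
proof (rule lipschitz_onI)
  fix x y
  have "\<bar>max 0 (k - x) - max 0 (k - y)\<bar> \<le> \<bar>x - y\<bar>"
    by (auto simp: max_def)
  then have "t * \<bar>max 0 (k - x) - max 0 (k - y)\<bar> \<le> t * \<bar>x - y\<bar>"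
    using assms by (rule mult_left_mono)
  moreover have "\<bar>kinked t k x - kinked t k y\<bar> \<le> \<bar>x - y\<bar> + \<bar>t * (max 0 (k - x) - max 0 (k - y))\<bar>"
    unfolding kinked_def right_diff_distrib by linarith
  ultimately show "dist (kinked t k x) (kinked t k y) \<le> (1 + t) * dist x y"
    using assms by (simp add: dist_real_def abs_mult distrib_right)
qed (use assms in simp)

lemma concave_on_kinked:
  assumes "0 \<le> t"
  shows "concave_on UNIV (kinked t k)"
proof -
  have "convex_on UNIV (\<lambda>w. t * max 0 (k - w) - w)"
  proof (rule convex_onI)
    fix s x y :: real assume s: "0 < s" "s < 1"
    have "(1 - s) * (k - x) \<le> (1 - s) * max 0 (k - x)" "s * (k - y) \<le> s * max 0 (k - y)"
        "0 \<le> (1 - s) * max 0 (k - x)" "0 \<le> s * max 0 (k - y)"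
      using s by (auto intro!: mult_left_mono)
    moreover have "k - ((1 - s) * x + s * y) = (1 - s) * (k - x) + s * (k - y)"
      by (simp add: algebra_simps)
    ultimately have "max 0 (k - ((1 - s) * x + s * y)) \<le> (1 - s) * max 0 (k - x) + s * max 0 (k - y)"
      by simp
    then have "t * max 0 (k - ((1 - s) * x + s * y)) \<le> t * ((1 - s) * max 0 (k - x) + s * max 0 (k - y))"
      using assms by (rule mult_left_mono)
    then show "t * max 0 (k - ((1 - s) *\<^sub>R x + s *\<^sub>R y)) - ((1 - s) *\<^sub>R x + s *\<^sub>R y)
        \<le> (1 - s) * (t * max 0 (k - x) - x) + s * (t * max 0 (k - y) - y)"
      by (simp add: algebra_simps)
  qed simp
  then show ?thesis
    by (simp add: concave_on_def kinked_def)
qed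

section \<open>The experiment and the menu\<close>

definition signal :: "real \<Rightarrow> real \<Rightarrow> real pmf" where
  "signal c w = (if w \<le> c then pmf_of_set {0, 1} else return_pmf 1)"

lemma pmf_signal:
  "pmf (signal c w) 0 = (if w \<le> c then 1 / 2 else 0)"
  "pmf (signal c w) 1 = (if w \<le> c then 1 / 2 else 1)"
  by (auto simp: signal_def)

text \<open>The odds of signal 0 against signal 1 fall from 1 to 0 as the state crosses
  \<open>c\<close>.\<close>

lemma MLR_ordered_signal: "MLR_ordered {0, 1} (signal c)"
  unfolding MLR_ordered_def by (auto simp: pmf_signal)

lemma linear_order_on_doubleton: "a \<noteq> b \<Longrightarrow> linear_order_on {a, b} {(a, a), (b, b), (a, b)}"
  by (auto simp: order_on_defs refl_on_def trans_def antisym_def total_on_def)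

text \<open>Insured wealth is the constant \<open>c\<close>, and the two assets cross exactly at
  \<open>c\<close>, which serves as \<open>w*\<close>. Compactness is that of a finite set.\<close>

lemma insurance_menu_full_insurance:
  assumes "finite_measure (interval_measure F)" "F_integrable F (\<lambda>w. w)"
  shows "insurance_menu F {zero_asset, \<lambda>w. c - w}"
proof -
  interpret finite_measure "interval_measure F" by fact
  let ?b = "\<lambda>w. c - w"
  have int: "F_integrable F b" if "b \<in> {zero_asset, ?b}" for b
    using that assms(2) by (auto simp: zero_asset_def)
  have "b \<in> topspace (L1_topology F)" if "b \<in> {zero_asset, ?b}" for b
    unfolding L1_topology_def topology_generated_by_topspace
  proof (rule UnionI)
    show "L1_ball F b 1 \<in> {L1_ball F b r | b r. F_integrable F b}"
      using int[OF that] by blast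
    show "b \<in> L1_ball F b 1"
      using int[OF that] by (simp add: L1_ball_def)
  qed
  then have "compactin (L1_topology F) {zero_asset, ?b}"
    by (intro finite_imp_compactin subsetI) simp_all
  then have "menu F {zero_asset, ?b}"
    unfolding menu_def using int by simp
  moreover have "insurance F b" if "b \<in> {zero_asset, ?b}" for b
    using that int[OF that] by (auto simp: insurance_def antimono_def mono_def zero_asset_def)
  moreover define R where "R = {(zero_asset, zero_asset), (?b, ?b), (zero_asset, ?b)}"
  have "linear_order_on {zero_asset, ?b} R"
  proof -
    \<comment> \<open>The order puts \<open>?b\<close> above \<open>zero_asset\<close>; antisymmetry
      requires the two to differ as functions.\<close>
    have "zero_asset (c - 1) \<noteq> ?b (c - 1)"
      by (simp add: zero_asset_def)
    then have "zero_asset \<noteq> ?b" by metis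
    then show ?thesis
      unfolding R_def by (rule linear_order_on_doubleton)
  qed
  moreover have "(\<forall>w. ereal w \<le> ereal c \<longrightarrow> b w \<le> b' w) \<and> (\<forall>w. ereal c \<le> ereal w \<longrightarrow> b' w \<le> b w)"
    if "(b, b') \<in> R" for b b'
    using that by (auto simp: R_def zero_asset_def)
  ultimately show ?thesis
    unfolding insurance_menu_def by (intro conjI exI[of _ "ereal c"] exI[of _ R]) (assumption | blast)+
qed

section \<open>Values of the four strategies\<close>

context density_environment
begin

text \<open>The high signal has probability at least 1/2 in every state. If the low one had
  probability 0, almost no mass would lie below \<open>c\<close> and the put with strike
  \<open>c\<close> would be worthless.\<close>

lemma is_experiment_signal:
  assumes tail: "super_exponential_left_tail f" and mean: "F_integrable F (\<lambda>w. w)"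
  shows "is_experiment F {0, 1} (signal c)"
proof -
  have meas: "(\<lambda>w. pmf (signal c w) x) \<in> borel_measurable borel" for x
    unfolding signal_def if_distrib[of "\<lambda>p. pmf p x"] by measurable
  have "marginal F (signal c) 0 \<noteq> 0"
  proof
    assume "marginal F (signal c) 0 = 0"
    then have "AE w in interval_measure F. pmf (signal c w) 0 = 0"
      unfolding marginal_def using integral_nonneg_eq_0_iff_AE[OF integrable_pmf_F[OF meas, of 0]] by simp
    then have "AE w in interval_measure F. max 0 (c - w) = 0"
      by eventually_elim (simp add: pmf_signal split: if_splits)
    then have "(LINT w|interval_measure F. max 0 (c - w)) = 0"
      by (rule integral_eq_zero_AE)
    with integral_put_pos[OF tail mean, of c] show False by simp
  qed
  then have "0 < marginal F (signal c) 0"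
    by (simp add: marginal_def less_le integral_nonneg_AE)
  moreover have "1 / 2 \<le> marginal F (signal c) 1"
    unfolding marginal_def by (intro F.integral_ge_const integrable_pmf_F[OF meas]) (auto simp: pmf_signal)
  ultimately show ?thesis
    using meas by (auto simp: is_experiment_def signal_def set_pmf_of_set)
qed

context
  assumes tail: "super_exponential_left_tail f" and mean: "F_integrable F (\<lambda>w. w)"
begin

text \<open>Insurance replaces \<open>w\<close> by \<open>c\<close>. Bought after the low signal
  alone, it adds half of \<open>max 0 (c - w)\<close> to wealth in expectation; bought after the
  high signal alone, it leaves that half uncovered.\<close>

lemma expected_utility_id:
  fixes c :: real
  defines "b \<equiv> \<lambda>w. c - w" and "m \<equiv> LINT w|interval_measure F. w"
    and "p \<equiv> LINT w|interval_measure F. max 0 (c - w)"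
  shows "\<beta> 0 = b \<Longrightarrow> \<beta> 1 = b \<Longrightarrow> expected_utility {0, 1} (signal c) (\<lambda>w. w) \<beta> \<mu> = c - \<mu>"
    "\<beta> 0 = zero_asset \<Longrightarrow> \<beta> 1 = zero_asset \<Longrightarrow>
      expected_utility {0, 1} (signal c) (\<lambda>w. w) \<beta> \<mu> = m - \<mu>"
    "\<beta> 0 = b \<Longrightarrow> \<beta> 1 = zero_asset \<Longrightarrow>
      expected_utility {0, 1} (signal c) (\<lambda>w. w) \<beta> \<mu> = m + p / 2 - \<mu>"
    "\<beta> 0 = zero_asset \<Longrightarrow> \<beta> 1 = b \<Longrightarrow>
      expected_utility {0, 1} (signal c) (\<lambda>w. w) \<beta> \<mu> = c - p / 2 - \<mu>"
proof -
  note int = mean integrable_put[OF mean, of c]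
  have eq: "expected_utility {0, 1} (signal c) (\<lambda>w. w) \<beta> \<mu> = (LINT w|interval_measure F. g w)"
    if "\<And>w. pmf (signal c w) 0 * (w + \<beta> 0 w - \<mu>) + pmf (signal c w) 1 * (w + \<beta> 1 w - \<mu>) = g w" for g
    using that by (simp add: expected_utility_def)
  show "expected_utility {0, 1} (signal c) (\<lambda>w. w) \<beta> \<mu> = c - \<mu>" if "\<beta> 0 = b" "\<beta> 1 = b"
  proof -
    have "expected_utility {0, 1} (signal c) (\<lambda>w. w) \<beta> \<mu> = (LINT w|interval_measure F. c - \<mu>)"
      by (rule eq) (simp add: that b_def zero_asset_def pmf_signal max_def field_simps)
    also have "\<dots> = c - \<mu>"
      by (simp add: int prob_F_UNIV m_def p_def)
    finally show ?thesis .
  qed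
  show "expected_utility {0, 1} (signal c) (\<lambda>w. w) \<beta> \<mu> = m - \<mu>" if "\<beta> 0 = zero_asset" "\<beta> 1 = zero_asset"
  proof -
    have "expected_utility {0, 1} (signal c) (\<lambda>w. w) \<beta> \<mu> = (LINT w|interval_measure F. w - \<mu>)"
      by (rule eq) (simp add: that b_def zero_asset_def pmf_signal max_def field_simps)
    also have "\<dots> = m - \<mu>"
      by (simp add: int prob_F_UNIV m_def p_def)
    finally show ?thesis .
  qed
  show "expected_utility {0, 1} (signal c) (\<lambda>w. w) \<beta> \<mu> = m + p / 2 - \<mu>" if "\<beta> 0 = b" "\<beta> 1 = zero_asset"
  proof -
    have "expected_utility {0, 1} (signal c) (\<lambda>w. w) \<beta> \<mu> = (LINT w|interval_measure F. w + max 0 (c - w) / 2 - \<mu>)"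
      by (rule eq) (simp add: that b_def zero_asset_def pmf_signal max_def field_simps)
    also have "\<dots> = m + p / 2 - \<mu>"
      by (simp add: int prob_F_UNIV m_def p_def)
    finally show ?thesis .
  qed
  show "expected_utility {0, 1} (signal c) (\<lambda>w. w) \<beta> \<mu> = c - p / 2 - \<mu>" if "\<beta> 0 = zero_asset" "\<beta> 1 = b"
  proof -
    have "expected_utility {0, 1} (signal c) (\<lambda>w. w) \<beta> \<mu> = (LINT w|interval_measure F. c - max 0 (c - w) / 2 - \<mu>)"
      by (rule eq) (simp add: that b_def zero_asset_def pmf_signal max_def field_simps)
    also have "\<dots> = c - p / 2 - \<mu>"
      by (simp add: int prob_F_UNIV m_def p_def)
    finally show ?thesis .
  qed
qed

lemma strategy_measurable_integrable:
  assumes "\<beta> \<in> {0, 1} \<rightarrow>\<^sub>E {zero_asset, \<lambda>w. c - w}" "x \<in> {0, 1}"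
  shows "\<beta> x \<in> borel_measurable borel" "F_integrable F (\<beta> x)"
proof -
  have zero: "zero_asset \<in> borel_measurable borel" "F_integrable F zero_asset"
    by (simp_all add: zero_asset_def)
  have b: "(\<lambda>w. c - w) \<in> borel_measurable borel"
    by measurable
  have b': "F_integrable F (\<lambda>w. c - w)"
    by (rule Bochner_Integration.integrable_diff[OF F.integrable_const mean])
  have "\<beta> x = zero_asset \<or> \<beta> x = (\<lambda>w. c - w)"
    using PiE_mem[OF assms] by (simp only: insert_iff empty_iff simp_thms)
  then show "\<beta> x \<in> borel_measurable borel" "F_integrable F (\<beta> x)"
    by (rule disjE; simp only: zero b b')+
qed

lemma expected_utility_signal:
  assumes \<beta>: "\<beta> \<in> {0, 1} \<rightarrow>\<^sub>E {zero_asset, \<lambda>w. c - w}" and u: "L-lipschitz_on UNIV u"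
  shows "ext_integral (interval_measure (wealth_CDF F f {0, 1} (signal c) \<mu> \<beta>)) u =
      ereal (expected_utility {0, 1} (signal c) u \<beta> \<mu>)"
    and "strict_mono u \<Longrightarrow> \<mu> < \<mu>' \<Longrightarrow>
      expected_utility {0, 1} (signal c) u \<beta> \<mu>' < expected_utility {0, 1} (signal c) u \<beta> \<mu>"
    and "continuous_on UNIV (expected_utility {0, 1} (signal c) u \<beta>)"
    and "F_integrable F (\<lambda>w. (\<Sum>x\<in>{0, 1}. pmf (signal c w) x * u (w + \<beta> x w - \<mu>)))"
proof -
  note facts = is_experiment_signal[OF tail mean] mean strategy_measurable_integrable[OF \<beta>] u
  show "ext_integral (interval_measure (wealth_CDF F f {0, 1} (signal c) \<mu> \<beta>)) u =
      ereal (expected_utility {0, 1} (signal c) u \<beta> \<mu>)"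
    by (rule ext_integral_wealth_CDF_eq_expected_utility[OF facts])
  show "expected_utility {0, 1} (signal c) u \<beta> \<mu>' < expected_utility {0, 1} (signal c) u \<beta> \<mu>"
    if "strict_mono u" "\<mu> < \<mu>'"
    by (rule expected_utility_strict_decreasing[OF facts that])
  show "continuous_on UNIV (expected_utility {0, 1} (signal c) u \<beta>)"
    by (rule continuous_on_expected_utility[OF facts])
  show "F_integrable F (\<lambda>w. (\<Sum>x\<in>{0, 1}. pmf (signal c w) x * u (w + \<beta> x w - \<mu>)))"
    by (rule integrable_ex_post_utility[OF facts])
qed

text \<open>At the fee \<open>p / 2\<close>, insuring after the low signal alone yields exactly the
  mean \<open>m\<close>. The other three strategies yield at most \<open>m - p / 2\<close>, as the
  premium makes \<open>c\<close> smaller than \<open>m\<close>.\<close>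

lemma willingness_to_pay_id:
  defines "m \<equiv> LINT w|interval_measure F. w"
  shows "is_willingness_to_pay F f {zero_asset, \<lambda>w. (m - 1) - w} {0, 1} (signal (m - 1)) (\<lambda>w. w)
    ((LINT w|interval_measure F. max 0 ((m - 1) - w)) / 2)"
proof -
  define c where "c = m - 1"
  define b where "b = (\<lambda>w::real. c - w)"
  define p where "p = (LINT w|interval_measure F. max 0 (c - w))"
  let ?V = "expected_utility {0, 1} (signal c) (\<lambda>w. w)"
  have p: "0 < p"
    unfolding p_def by (rule integral_put_pos[OF tail mean])
  have val: "?V \<beta> (p / 2) \<le> m" if "\<beta> \<in> {0, 1} \<rightarrow>\<^sub>E {zero_asset, b}" for \<beta>
  proof -
    have "\<beta> 0 \<in> {zero_asset, b}" "\<beta> 1 \<in> {zero_asset, b}"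
      using that by auto
    then show ?thesis
      using p expected_utility_id[of \<beta> c "p / 2"] unfolding b_def p_def m_def c_def by auto
  qed
  define \<beta> where "\<beta> = (\<lambda>x\<in>{0, 1::real}. if x = 0 then b else zero_asset)"
  have \<beta>: "\<beta> \<in> {0, 1} \<rightarrow>\<^sub>E {zero_asset, b}" "?V \<beta> (p / 2) = m"
    using expected_utility_id(3)[of \<beta> c "p / 2"] by (auto simp: \<beta>_def b_def m_def p_def)
  have "is_willingness_to_pay F f {zero_asset, b} {0, 1} (signal c) (\<lambda>w. w) (p / 2)"
  proof (rule is_willingness_to_payI[where V="?V" and \<beta>=\<beta>])
    show "?V \<beta> \<mu>' < ?V \<beta> \<mu>" if "\<beta> \<in> {0, 1} \<rightarrow>\<^sub>E {zero_asset, b}" "\<mu> < \<mu>'" for \<beta> \<mu> \<mu>'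
      using that(1) unfolding b_def
      by (rule expected_utility_signal(2)[OF _ lipschitz_id _ that(2)]) (simp add: strict_mono_def)
    show "ext_integral (interval_measure (wealth_CDF F f {0, 1} (signal c) \<mu> \<beta>)) (\<lambda>w. w) = ereal (?V \<beta> \<mu>)"
      if "\<beta> \<in> {0, 1} \<rightarrow>\<^sub>E {zero_asset, b}" for \<beta> \<mu>
      using that unfolding b_def by (rule expected_utility_signal(1)[OF _ lipschitz_id])
  qed (use p val \<beta> in \<open>auto simp: m_def\<close>)
  then show ?thesis
    unfolding b_def p_def c_def .
qed

text \<open>A crude bound, enough for the strategies that already lose \<open>p / 2\<close> under
  risk neutrality.\<close>

lemma expected_utility_kinked_le:
  assumes \<beta>: "\<beta> \<in> {0, 1} \<rightarrow>\<^sub>E {zero_asset, \<lambda>w. c - w}" and "0 \<le> t"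
  shows "expected_utility {0, 1} (signal c) (kinked t k) \<beta> \<mu>
    \<le> expected_utility {0, 1} (signal c) (\<lambda>w. w) \<beta> \<mu>"
  unfolding expected_utility_def
  using expected_utility_signal(4)[OF \<beta> lipschitz_on_kinked[OF \<open>0 \<le> t\<close>]]
    expected_utility_signal(4)[OF \<beta> lipschitz_id]
  by (intro integral_mono sum_mono mult_left_mono kinked_le \<open>0 \<le> t\<close>) auto

text \<open>After the high signal, which has probability at least one half in every state, the fee \<open>\<mu>\<close> is
  paid without any compensation.\<close>

lemma expected_utility_kinked_insured_le:
  assumes \<beta>: "\<beta> \<in> {0, 1} \<rightarrow>\<^sub>E {zero_asset, \<lambda>w. c - w}" "\<beta> 1 = zero_asset" and "0 \<le> t"
  shows "expected_utility {0, 1} (signal c) (kinked t k) \<beta> \<mu>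
    \<le> expected_utility {0, 1} (signal c) (\<lambda>w. w) \<beta> \<mu>
      - t / 2 * (LINT w|interval_measure F. max 0 (k + \<mu> - w))"
proof -
  let ?V = "\<lambda>u w. \<Sum>x\<in>{0, 1}. pmf (signal c w) x * u (w + \<beta> x w - \<mu>)"
  note int = expected_utility_signal(4)[OF \<beta>(1) lipschitz_on_kinked[OF \<open>0 \<le> t\<close>]]
    expected_utility_signal(4)[OF \<beta>(1) lipschitz_id]
  have int_put: "F_integrable F (\<lambda>w. t / 2 * max 0 (k + \<mu> - w))"
    by (intro integrable_mult_right integrable_put mean)
  have "?V (kinked t k) w \<le> ?V (\<lambda>w. w) w - t / 2 * max 0 (k + \<mu> - w)" for w
  proof -
    \<comment> \<open>After the low signal the shortfall below \<open>k\<close> is simply dropped;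
      the bound keeps only the one after the high signal.\<close>
    have "pmf (signal c w) 0 * kinked t k (w + \<beta> 0 w - \<mu>) \<le> pmf (signal c w) 0 * (w + \<beta> 0 w - \<mu>)"
      by (intro mult_left_mono kinked_le \<open>0 \<le> t\<close>) simp
    moreover have "1 / 2 * (t * max 0 (k + \<mu> - w)) \<le> pmf (signal c w) 1 * (t * max 0 (k + \<mu> - w))"
      using \<open>0 \<le> t\<close> by (intro mult_right_mono) (auto simp: pmf_signal)
    moreover have "kinked t k (w + \<beta> 1 w - \<mu>) = (w + \<beta> 1 w - \<mu>) - t * max 0 (k + \<mu> - w)"
      by (simp add: kinked_def \<beta>(2) zero_asset_def algebra_simps)
    ultimately show ?thesis
      by (simp add: right_diff_distrib)
  qed
  then have "(LINT w|interval_measure F. ?V (kinked t k) w)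
      \<le> (LINT w|interval_measure F. ?V (\<lambda>w. w) w - t / 2 * max 0 (k + \<mu> - w))"
    by (intro integral_mono int(1) Bochner_Integration.integrable_diff int(2) int_put)
  also have "\<dots> = (LINT w|interval_measure F. ?V (\<lambda>w. w) w)
      - (LINT w|interval_measure F. t / 2 * max 0 (k + \<mu> - w))"
    by (rule Bochner_Integration.integral_diff[OF int(2) int_put])
  finally show ?thesis
    by (simp add: expected_utility_def)
qed

text \<open>Insured wealth is constant, so (ZAZI) compares \<open>u c\<close> with the expected
  utility of the status quo.\<close>

lemma ZAZI_full_insurance:
  assumes "L-lipschitz_on UNIV u" "u c \<le> (LINT w|interval_measure F. u w)"
  shows "ZAZI F {zero_asset, \<lambda>w. c - w} u"
proof -
  have "ext_integral (interval_measure F) (\<lambda>w. u (w + zero_asset w)) = ereal (LINT w|interval_measure F. u w)"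
    using lipschitz_on_imp_integrable[OF assms(1) F.finite_measure_axioms mean]
    by (simp add: zero_asset_def ext_integral_eq_integral)
  moreover have "ext_integral (interval_measure F) (\<lambda>w. u (w + (c - w))) = ereal (u c)"
    by (simp add: ext_integral_eq_integral prob_F_UNIV)
  ultimately show ?thesis
    using assms(2) by (auto simp: ZAZI_def is_arg_max_def)
qed

lemma integral_kinked:
  "(LINT w|interval_measure F. kinked t k w) =
    (LINT w|interval_measure F. w) - t * (LINT w|interval_measure F. max 0 (k - w))"
  unfolding kinked_def using mean integrable_put[OF mean] by simp

text \<open>At the risk-neutral willingness to pay \<open>p / 2\<close>, every strategy is strictly
  worse than the status quo for a suitable kinked utility.\<close>

lemma ex_kinked_willingness_to_pay_less:
  fixes c p :: real
  defines "c \<equiv> (LINT w|interval_measure F. w) - 1"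
    and "p \<equiv> LINT w|interval_measure F. max 0 (c - w)"
  shows "\<exists>t k M. 0 \<le> t \<and> M < p / 2 \<and> ZAZI F {zero_asset, \<lambda>w. c - w} (kinked t k) \<and>
    is_willingness_to_pay F f {zero_asset, \<lambda>w. c - w} {0, 1} (signal c) (kinked t k) M"
proof -
  let ?b = "\<lambda>w. c - w"
  define m where "m = (LINT w|interval_measure F. w)"
  define \<Phi> where "\<Phi> k = (LINT w|interval_measure F. max 0 (k - w))" for k
  have p: "0 < p"
    unfolding p_def by (rule integral_put_pos[OF tail mean])
  \<comment> \<open>The factor 2 offsets the probability 1/2 with which the uncompensated fee is at
    least paid.\<close>
  obtain k where k: "2 * \<Phi> k < \<Phi> (k + p / 2)"
    using put_growth[OF tail mean, of "p / 2" 2] p unfolding \<Phi>_def by auto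
  \<comment> \<open>The kink must cost the status quo less than the premium loading 1, for (ZAZI),
    and less than \<open>p / 2\<close>, to rule out the other strategies. The summand 1 in the
    denominator makes both bounds strict.\<close>
  define t where "t = min 1 (p / 2) / (\<Phi> k + 1)"
  have "0 < \<Phi> k"
    unfolding \<Phi>_def by (rule integral_put_pos[OF tail mean])
  then have t: "0 < t" and "t * (\<Phi> k + 1) = min 1 (p / 2)"
    using p by (auto simp: t_def)
  then have t\<Phi>: "t * \<Phi> k < 1" "t * \<Phi> k < p / 2"
    by (auto simp: distrib_left)
  have t': "0 \<le> t" using t by simp
  let ?u = "kinked t k"
  let ?V = "expected_utility {0, 1} (signal c) ?u"
  note u = lipschitz_on_kinked[OF t']
  have u_F: "(LINT w|interval_measure F. ?u w) = m - t * \<Phi> k"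
    by (simp add: integral_kinked m_def \<Phi>_def)
  have "\<exists>M<p / 2. is_willingness_to_pay F f {zero_asset, ?b} {0, 1} (signal c) ?u M"
  proof (rule ex_is_willingness_to_pay_less[where V="?V" and \<beta>="\<lambda>x\<in>{0, 1}. zero_asset"])
    show "?V \<beta> (p / 2) < (LINT w|interval_measure F. ?u w)" if \<beta>: "\<beta> \<in> {0, 1} \<rightarrow>\<^sub>E {zero_asset, ?b}" for \<beta>
    proof -
      have "\<beta> 0 \<in> {zero_asset, ?b}" "\<beta> 1 \<in> {zero_asset, ?b}"
        using \<beta> by auto
      then consider (insured) "\<beta> 0 = ?b" "\<beta> 1 = zero_asset"
        | (other) "expected_utility {0, 1} (signal c) (\<lambda>w. w) \<beta> (p / 2) \<le> m - p / 2"
        using p expected_utility_id[of \<beta> c "p / 2"] unfolding m_def p_def c_def by auto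
      then show ?thesis
      proof cases
        case insured
        \<comment> \<open>At this fee the risk-neutral value of the strategy is exactly
          \<open>m\<close>, so the kink alone decides.\<close>
        have "?V \<beta> (p / 2) \<le> m - t / 2 * \<Phi> (k + p / 2)"
          using expected_utility_kinked_insured_le[OF \<beta> insured(2) t', of k "p / 2"]
            expected_utility_id(3)[of \<beta> c "p / 2", OF insured] by (simp add: m_def p_def \<Phi>_def)
        also have "t / 2 * (2 * \<Phi> k) < t / 2 * \<Phi> (k + p / 2)"
          using k t by (intro mult_strict_left_mono) auto
        then have "m - t / 2 * \<Phi> (k + p / 2) < m - t * \<Phi> k" by simp
        finally show ?thesis unfolding u_F .
      next
        case other
        with expected_utility_kinked_le[OF \<beta> t', of k "p / 2"] t\<Phi> show ?thesis
          unfolding u_F by simp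
      qed
    qed
    show "(LINT w|interval_measure F. ?u w) \<le> ?V (\<lambda>x\<in>{0, 1}. zero_asset) 0"
      unfolding expected_utility_def
      by (intro eq_refl Bochner_Integration.integral_cong) (auto simp: zero_asset_def pmf_signal)
    show "ext_integral (interval_measure (wealth_CDF F f {0, 1} (signal c) \<mu> \<beta>)) ?u = ereal (?V \<beta> \<mu>)"
      if "\<beta> \<in> {0, 1} \<rightarrow>\<^sub>E {zero_asset, ?b}" for \<beta> \<mu>
      by (rule expected_utility_signal(1)[OF that u])
    show "?V \<beta> \<mu>' < ?V \<beta> \<mu>" if "\<beta> \<in> {0, 1} \<rightarrow>\<^sub>E {zero_asset, ?b}" "\<mu> < \<mu>'" for \<beta> \<mu> \<mu>'
      by (rule expected_utility_signal(2)[OF that(1) u strict_mono_kinked[OF t'] that(2)])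
    show "continuous_on UNIV (?V \<beta>)" if "\<beta> \<in> {0, 1} \<rightarrow>\<^sub>E {zero_asset, ?b}" for \<beta>
      by (rule expected_utility_signal(3)[OF that u])
  qed (use p in auto)
  moreover have "ZAZI F {zero_asset, ?b} ?u"
    using kinked_le[OF t', of k c] t\<Phi> by (intro ZAZI_full_insurance[OF u]) (simp add: u_F c_def m_def)
  ultimately show ?thesis
    using t' by blast
qed

end
end

theorem proposition3:
  fixes F f :: "real \<Rightarrow> real"
  assumes "is_CDF F"
    and "F_integrable F (\<lambda>w. \<bar>w\<bar>)"
    and "has_density F f"
    and "super_exponential_left_tail f"
  shows "\<exists>(b :: real \<Rightarrow> real) (X :: real set) (h :: real \<Rightarrow> real pmf)
           (u :: real \<Rightarrow> real) (v :: real \<Rightarrow> real).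
    insurance_menu F {zero_asset, b} \<and>
    is_experiment F X h \<and> card X = 2 \<and> MLR_ordered X h \<and>
    u \<in> utilities F \<and> v \<in> utilities F \<and>
    (\<exists>L. L-lipschitz_on UNIV u) \<and> (\<exists>L. L-lipschitz_on UNIV v) \<and>
    concave_on UNIV u \<and> concave_on UNIV v \<and>
    ZAZI F {zero_asset, b} u \<and> ZAZI F {zero_asset, b} v \<and>
    more_risk_averse u v \<and>
    willingness_to_pay F f {zero_asset, b} X h u < willingness_to_pay F f {zero_asset, b} X h v"
proof -
  interpret density_environment F f
    by unfold_locales fact+
  note tail = assms(4)
  have mean: "F_integrable F (\<lambda>w. w)"
    using assms(2) by (rule integrable_abs_iff[THEN iffD1, rotated]) simp
  define c where "c = (LINT w|interval_measure F. w) - 1"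
  let ?b = "\<lambda>w. c - w"
  obtain t k M where t: "0 \<le> t"
    and M: "M < (LINT w|interval_measure F. max 0 (c - w)) / 2"
      "is_willingness_to_pay F f {zero_asset, ?b} {0, 1} (signal c) (kinked t k) M"
    and ZAZI_u: "ZAZI F {zero_asset, ?b} (kinked t k)"
    using ex_kinked_willingness_to_pay_less[OF tail mean] unfolding c_def by blast
  have "ZAZI F {zero_asset, ?b} (\<lambda>w. w)"
    by (rule ZAZI_full_insurance[OF tail mean lipschitz_id]) (simp add: c_def)
  moreover have "kinked t k \<in> utilities F" "(\<lambda>w. w) \<in> utilities F"
    using lipschitz_on_imp_utility[OF lipschitz_on_kinked[OF t] strict_mono_kinked[OF t] F.finite_measure_axioms mean]
      lipschitz_on_imp_utility[OF lipschitz_id _ F.finite_measure_axioms mean]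
    by (auto simp: strict_mono_def)
  moreover have "more_risk_averse (kinked t k) (\<lambda>w. w)"
    \<comment> \<open>Since \<open>v\<close> is the identity, the concave transformation is
      \<open>u\<close> itself.\<close>
    unfolding more_risk_averse_def
    by (intro exI[of _ "kinked t k"]) (auto simp: strict_mono_kinked t concave_on_kinked)
  moreover have "concave_on UNIV (\<lambda>w::real. w)"
    \<comment> \<open>The identity is the kinked utility with \<open>t = 0\<close>.\<close>
    using concave_on_kinked[of 0 0] by (simp add: kinked_def[abs_def])
  moreover have "willingness_to_pay F f {zero_asset, ?b} {0, 1} (signal c) (kinked t k) <
      willingness_to_pay F f {zero_asset, ?b} {0, 1} (signal c) (\<lambda>w. w)"
    using M willingness_to_pay_id[OF tail mean] unfolding c_def[symmetric]
    by (simp add: willingness_to_pay_eqI)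
  ultimately show ?thesis
    using ZAZI_u insurance_menu_full_insurance[OF F.finite_measure_axioms mean, of c]
      is_experiment_signal[OF tail mean, of c] MLR_ordered_signal[of c]
      lipschitz_on_kinked[OF t, of k] lipschitz_id concave_on_kinked[OF t, of k]
    by (intro exI[of _ ?b] exI[of _ "{0, 1}"] exI[of _ "signal c"] exI[of _ "kinked t k"]
        exI[of _ "\<lambda>w. w"] conjI) (assumption | simp | blast)+
qed

end
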